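(* Let $(L_i)_{i\in I}$ be an arbitrary family of countably presented frames and put $L=\prod_{i\in I}L_i$ with the coordinatewise order. Then the Scott space $\Sigma L$ is sober.
   Context: A frame is a complete lattice $L$ with $a\wedge\bigvee S=\bigvee_{s\in S}(a\wedge s)$ for all $a\in L$, $S\subseteq L$. A frame is countably presented if it admits a presentation by generators and relations in the category of frames (morphisms preserve finite meets and arbitrary joins) with countably many generators and countably many relations (i.e. it is isomorphic to the quotient of the free frame on a countable set by the frame congruence generated by a countable set of pairs of elements). For a poset $P$, a subset $U$ is Scott open if it is an upper set and every directed set $D$ having a supremum $\bigvee D\in U$ meets $U$; $\Sigma P$ is $P$ with the topology of Scott-open sets. A $T_0$ space is sober if every (nonempty) irreducible closed subset is the closure of a unique point. *)

theory Defs
  imports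
    "HOL-Library.Countable_Set"
    "HOL-Library.FuncSet"
    "HOL-Algebra.Complete_Lattice"
    "HOL-Analysis.Abstract_Topological_Spaces"
begin

section \<open>Frames\<close>

locale frame = complete_lattice L for L :: "'a gorder" (structure) +
  assumes meet_Sup_distrib:
    "\<lbrakk>a \<in> carrier L; S \<subseteq> carrier L\<rbrakk> \<Longrightarrow> a \<sqinter> \<Squnion>S = \<Squnion>((\<lambda>s. a \<sqinter> s) ` S)"

definition frame_hom :: "'a gorder \<Rightarrow> 'b gorder \<Rightarrow> ('a \<Rightarrow> 'b) \<Rightarrow> bool" where
  "frame_hom L M f \<longleftrightarrow>
     f \<in> carrier L \<rightarrow> carrier M \<and>
     f \<top>\<^bsub>L\<^esub> = \<top>\<^bsub>M\<^esub> \<and>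
     (\<forall>a\<in>carrier L. \<forall>b\<in>carrier L. f (a \<sqinter>\<^bsub>L\<^esub> b) = f a \<sqinter>\<^bsub>M\<^esub> f b) \<and>
     (\<forall>S. S \<subseteq> carrier L \<longrightarrow> f (\<Squnion>\<^bsub>L\<^esub>S) = \<Squnion>\<^bsub>M\<^esub>(f ` S))"

definition frame_isomorphic :: "'a gorder \<Rightarrow> 'b gorder \<Rightarrow> bool" where
  "frame_isomorphic L M \<longleftrightarrow> (\<exists>f. frame_hom L M f \<and> bij_betw f (carrier L) (carrier M))"

definition product_order :: "'i set \<Rightarrow> ('i \<Rightarrow> 'a gorder) \<Rightarrow> ('i \<Rightarrow> 'a) gorder" where
  "product_order I L =
     \<lparr>carrier = (\<Pi>\<^sub>E i\<in>I. carrier (L i)),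
      eq = (=),
      le = (\<lambda>x y. \<forall>i\<in>I. x i \<sqsubseteq>\<^bsub>L i\<^esub> y i)\<rparr>"

section \<open>Presentations of frames\<close>

text \<open>
  The free frame on \<open>X\<close> is realised as the free suplattice on the free meet-semilattice on \<open>X\<close>.
  The latter consists of the finite subsets of \<open>X\<close> under reverse inclusion (a finite set \<open>F\<close>
  stands for the meet of the generators in \<open>F\<close>), so the former consists of the
  inclusion-upward closed families of finite subsets of \<open>X\<close>. The universal property is proved
  in \<open>free_frame_universal\<close> below.
\<close>

definition free_frame :: "'g set \<Rightarrow> 'g set set gorder" where
  "free_frame X =
     \<lparr>carrier = {U. (\<forall>F\<in>U. finite F \<and> F \<subseteq> X) \<and>
                    (\<forall>F\<in>U. \<forall>G. finite G \<and> F \<subseteq> G \<and> G \<subseteq> X \<longrightarrow> G \<in> U)},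
      eq = (=),
      le = (\<subseteq>)\<rparr>"

definition free_gen :: "'g set \<Rightarrow> 'g \<Rightarrow> 'g set set" where
  "free_gen X x = {F. finite F \<and> F \<subseteq> X \<and> x \<in> F}"

text \<open>
  In the last clause a family of related pairs is given as a subset \<open>S\<close> of \<open>\<theta>\<close>.
  Empty meets and joins are covered by reflexivity.
\<close>

definition frame_congruence :: "'a gorder \<Rightarrow> ('a \<times> 'a) set \<Rightarrow> bool" where
  "frame_congruence L \<theta> \<longleftrightarrow>
     equiv (carrier L) \<theta> \<and>
     (\<forall>a b c d. (a, b) \<in> \<theta> \<and> (c, d) \<in> \<theta> \<longrightarrow> (a \<sqinter>\<^bsub>L\<^esub> c, b \<sqinter>\<^bsub>L\<^esub> d) \<in> \<theta>) \<and>
     (\<forall>S. S \<subseteq> \<theta> \<longrightarrow> (\<Squnion>\<^bsub>L\<^esub>(fst ` S), \<Squnion>\<^bsub>L\<^esub>(snd ` S)) \<in> \<theta>)"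

definition generated_congruence :: "'a gorder \<Rightarrow> ('a \<times> 'a) set \<Rightarrow> ('a \<times> 'a) set" where
  "generated_congruence L R = \<Inter>{\<theta>. frame_congruence L \<theta> \<and> R \<subseteq> \<theta>}"

text \<open>
  The order on congruence classes is that of the quotient algebra:
  \<open>[a] \<le> [b]\<close> iff \<open>[a \<and> b] = [a]\<close>. The universal property of the quotient by a
  generated congruence is proved in \<open>quotient_frame_universal\<close> below.
\<close>

definition quotient_frame :: "'a gorder \<Rightarrow> ('a \<times> 'a) set \<Rightarrow> 'a set gorder" where
  "quotient_frame L \<theta> =
     \<lparr>carrier = carrier L // \<theta>,
      eq = (=),
      le = (\<lambda>A B. \<exists>a\<in>A. \<exists>b\<in>B. a \<sqinter>\<^bsub>L\<^esub> b \<in> A)\<rparr>"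

definition presented_frame :: "'g set \<Rightarrow> ('g set set \<times> 'g set set) set \<Rightarrow> 'g set set set gorder" where
  "presented_frame X R =
     quotient_frame (free_frame X) (generated_congruence (free_frame X) R)"

text \<open>Every countable set of generators may be taken to be a set of natural numbers.\<close>

definition countably_presented_frame :: "'a gorder \<Rightarrow> bool" where
  "countably_presented_frame L \<longleftrightarrow>
     frame L \<and>
     (\<exists>(X :: nat set) R.
        R \<subseteq> carrier (free_frame X) \<times> carrier (free_frame X) \<and> countable R \<and>
        frame_isomorphic L (presented_frame X R))"

section \<open>Scott topology and sobriety\<close>

definition directed_in :: "'a gorder \<Rightarrow> 'a set \<Rightarrow> bool" where
  "directed_in P D \<longleftrightarrow>
     D \<subseteq> carrier P \<and> D \<noteq> {} \<and> (\<forall>x\<in>D. \<forall>y\<in>D. \<exists>z\<in>D. x \<sqsubseteq>\<^bsub>P\<^esub> z \<and> y \<sqsubseteq>\<^bsub>P\<^esub> z)"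

definition scott_open :: "'a gorder \<Rightarrow> 'a set \<Rightarrow> bool" where
  "scott_open P U \<longleftrightarrow>
     U \<subseteq> carrier P \<and>
     (\<forall>x\<in>U. \<forall>y\<in>carrier P. x \<sqsubseteq>\<^bsub>P\<^esub> y \<longrightarrow> y \<in> U) \<and>
     (\<forall>D s. directed_in P D \<and> is_lub P s D \<and> s \<in> U \<longrightarrow> D \<inter> U \<noteq> {})"

definition scott_topology :: "'a gorder \<Rightarrow> 'a topology" where
  "scott_topology P = topology (scott_open P)"

definition irreducible_closedin :: "'a topology \<Rightarrow> 'a set \<Rightarrow> bool" where
  "irreducible_closedin T C \<longleftrightarrow>
     closedin T C \<and> C \<noteq> {} \<and>
     (\<forall>A B. closedin T A \<and> closedin T B \<and> C \<subseteq> A \<union> B \<longrightarrow> C \<subseteq> A \<or> C \<subseteq> B)"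

definition sober_space :: "'a topology \<Rightarrow> bool" where
  "sober_space T \<longleftrightarrow>
     t0_space T \<and>
     (\<forall>C. irreducible_closedin T C \<longrightarrow> (\<exists>!x. x \<in> topspace T \<and> T closure_of {x} = C))"

section \<open>Basic properties\<close>

lemma istopology_scott_open: "istopology (scott_open P)"
  unfolding istopology_def
proof (intro conjI allI impI)
  fix U V assume U: "scott_open P U" and V: "scott_open P V"
  show "scott_open P (U \<inter> V)"
    unfolding scott_open_def
  proof (intro conjI allI impI ballI)
    fix D s assume D: "directed_in P D \<and> is_lub P s D \<and> s \<in> U \<inter> V"
    then obtain x y where x: "x \<in> D" "x \<in> U" and y: "y \<in> D" "y \<in> V"
      using U V unfolding scott_open_def by blast
    then obtain z where "z \<in> D" "x \<sqsubseteq>\<^bsub>P\<^esub> z" "y \<sqsubseteq>\<^bsub>P\<^esub> z" "z \<in> carrier P"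
      using D unfolding directed_in_def by blast
    moreover from this have "z \<in> U" "z \<in> V"
      using U V x(2) y(2) unfolding scott_open_def by metis+
    ultimately show "D \<inter> (U \<inter> V) \<noteq> {}" by blast
  qed (use U V in \<open>auto simp: scott_open_def\<close>)
next
  fix \<U> assume \<U>: "\<forall>U\<in>\<U>. scott_open P U"
  show "scott_open P (\<Union>\<U>)"
    unfolding scott_open_def
  proof (intro conjI allI impI ballI)
    fix D s assume D: "directed_in P D \<and> is_lub P s D \<and> s \<in> \<Union>\<U>"
    then obtain U where "U \<in> \<U>" "s \<in> U" by blast
    moreover from this have "scott_open P U" using \<U> by blast
    ultimately have "D \<inter> U \<noteq> {}"
      using D unfolding scott_open_def by metis
    then show "D \<inter> \<Union>\<U> \<noteq> {}"
      using \<open>U \<in> \<U>\<close> by blast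
  qed (use \<U> in \<open>unfold scott_open_def, blast+\<close>)
qed

lemma openin_scott_topology [simp]: "openin (scott_topology P) U \<longleftrightarrow> scott_open P U"
  by (simp add: scott_topology_def istopology_scott_open)

lemma topspace_scott_topology [simp]: "topspace (scott_topology P) = carrier P"
proof -
  have "scott_open P (carrier P)"
    by (auto simp: scott_open_def directed_in_def)
  moreover have "U \<subseteq> carrier P" if "scott_open P U" for U
    using that by (simp add: scott_open_def)
  ultimately show ?thesis
    unfolding topspace_def openin_scott_topology by blast
qed

lemma (in complete_lattice) Sup_eqI:
  "is_lub L x A \<Longrightarrow> \<Squnion>A = x"
  unfolding sup_def by (metis least_unique someI)

lemma (in complete_lattice) Inf_eqI:
  "greatest L x (Lower L A) \<Longrightarrow> \<Sqinter>A = x"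
  unfolding inf_def by (metis greatest_unique someI)

lemma (in complete_lattice) is_lub_Sup: "A \<subseteq> carrier L \<Longrightarrow> is_lub L (\<Squnion>A) A"
  by (rule supI)

lemma (in complete_lattice) top_eqI:
  "x \<in> carrier L \<Longrightarrow> (\<And>y. y \<in> carrier L \<Longrightarrow> y \<sqsubseteq> x) \<Longrightarrow> \<top> = x"
  by (metis le_antisym top_closed top_higher)

lemma (in complete_lattice) meet_eqI:
  assumes "x \<in> carrier L" "y \<in> carrier L" "z \<in> carrier L" "z \<sqsubseteq> x" "z \<sqsubseteq> y"
    "\<And>w. w \<in> carrier L \<Longrightarrow> w \<sqsubseteq> x \<Longrightarrow> w \<sqsubseteq> y \<Longrightarrow> w \<sqsubseteq> z"
  shows "x \<sqinter> y = z"
  unfolding meet_def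
proof (rule Inf_eqI, rule greatest_LowerI)
  fix w assume "w \<in> Lower L {x, y}"
  then show "w \<sqsubseteq> z"
    using assms(1,2,6) unfolding Lower_def by blast
qed (use assms in auto)

lemma complete_latticeI_Sup:
  assumes "partial_order L" and "\<And>A. A \<subseteq> carrier L \<Longrightarrow> \<exists>s. is_lub L s A"
  shows "complete_lattice L"
proof -
  interpret partial_order L by fact
  show ?thesis
  proof
    fix A assume A: "A \<subseteq> carrier L"
    obtain s where "is_lub L s (Lower L A)" using assms(2)[of "Lower L A"] by auto
    then have "greatest L s (Lower L A)"
      using A unfolding least_def greatest_def Upper_def Lower_def by blast
    then show "\<exists>i. greatest L i (Lower L A)" ..
  qed (fact assms(2))
qed

lemma free_frame_sel [simp]:
  "le (free_frame X) = (\<subseteq>)" "eq (free_frame X) = (=)"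
  by (simp_all add: free_frame_def)

lemma in_carrier_free_frame_iff:
  "U \<in> carrier (free_frame X) \<longleftrightarrow>
     (\<forall>F\<in>U. finite F \<and> F \<subseteq> X) \<and>
     (\<forall>F\<in>U. \<forall>G. finite G \<and> F \<subseteq> G \<and> G \<subseteq> X \<longrightarrow> G \<in> U)"
  by (simp add: free_frame_def)

lemma Union_in_carrier_free_frame:
  assumes "\<A> \<subseteq> carrier (free_frame X)"
  shows "\<Union>\<A> \<in> carrier (free_frame X)"
  unfolding in_carrier_free_frame_iff
proof (intro conjI ballI allI impI)
  fix F assume "F \<in> \<Union>\<A>"
  then obtain U where U: "U \<in> \<A>" "F \<in> U" by blast
  then have U': "U \<in> carrier (free_frame X)" using assms by blast
  show "finite F" "F \<subseteq> X" using U(2) U' by (simp_all add: in_carrier_free_frame_iff)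
  fix G assume "finite G \<and> F \<subseteq> G \<and> G \<subseteq> X"
  then have "G \<in> U" using U(2) U' unfolding in_carrier_free_frame_iff by metis
  then show "G \<in> \<Union>\<A>" using U(1) by blast
qed

lemma Int_in_carrier_free_frame:
  assumes "U \<in> carrier (free_frame X)" "V \<in> carrier (free_frame X)"
  shows "U \<inter> V \<in> carrier (free_frame X)"
  using assms unfolding in_carrier_free_frame_iff by (metis IntD1 IntD2 IntI)

lemma is_lub_free_frame:
  assumes "\<A> \<subseteq> carrier (free_frame X)"
  shows "is_lub (free_frame X) (\<Union>\<A>) \<A>"
proof (rule least_UpperI)
  fix V assume "V \<in> Upper (free_frame X) \<A>"
  then have "U \<subseteq> V" if "U \<in> \<A>" for U
    using that assms Upper_memD by fastforce
  then show "\<Union>\<A> \<sqsubseteq>\<^bsub>free_frame X\<^esub> V" by (simp add: Union_least)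
qed (use assms Union_in_carrier_free_frame[OF assms] in \<open>simp_all add: Union_upper\<close>)

lemma complete_lattice_free_frame: "complete_lattice (free_frame X)"
proof (rule complete_latticeI_Sup)
  show "partial_order (free_frame X)"
    by (unfold_locales; simp)
  show "\<exists>s. is_lub (free_frame X) s A" if "A \<subseteq> carrier (free_frame X)" for A
    using is_lub_free_frame[OF that] by (rule exI)
qed

lemma free_frame_simps:
  shows Sup_free_frame: "\<A> \<subseteq> carrier (free_frame X) \<Longrightarrow> \<Squnion>\<^bsub>free_frame X\<^esub>\<A> = \<Union>\<A>"
    and meet_free_frame: "\<lbrakk>U \<in> carrier (free_frame X); V \<in> carrier (free_frame X)\<rbrakk> \<Longrightarrow>
      U \<sqinter>\<^bsub>free_frame X\<^esub> V = U \<inter> V"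
    and top_free_frame: "\<top>\<^bsub>free_frame X\<^esub> = {F. finite F \<and> F \<subseteq> X}"
proof -
  interpret complete_lattice "free_frame X" by (rule complete_lattice_free_frame)
  show "\<Squnion>\<^bsub>free_frame X\<^esub>\<A> = \<Union>\<A>" if "\<A> \<subseteq> carrier (free_frame X)"
    by (rule Sup_eqI[OF is_lub_free_frame[OF that]])
  show "U \<sqinter>\<^bsub>free_frame X\<^esub> V = U \<inter> V"
    if "U \<in> carrier (free_frame X)" "V \<in> carrier (free_frame X)"
  proof (rule meet_eqI[OF that])
    show "U \<inter> V \<in> carrier (free_frame X)"
      by (rule Int_in_carrier_free_frame[OF that])
  qed simp_all
  show "\<top>\<^bsub>free_frame X\<^esub> = {F. finite F \<and> F \<subseteq> X}"
    by (rule top_eqI) (auto simp: in_carrier_free_frame_iff)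
qed

lemma frame_free_frame: "frame (free_frame X)"
proof -
  interpret complete_lattice "free_frame X" by (rule complete_lattice_free_frame)
  show ?thesis
  proof
    fix U \<A> assume U: "U \<in> carrier (free_frame X)" and \<A>: "\<A> \<subseteq> carrier (free_frame X)"
    have *: "(\<lambda>V. U \<sqinter>\<^bsub>free_frame X\<^esub> V) ` \<A> = (\<lambda>V. U \<inter> V) ` \<A>"
      using U \<A> by (intro image_cong refl meet_free_frame) blast+
    have **: "(\<lambda>V. U \<inter> V) ` \<A> \<subseteq> carrier (free_frame X)"
      using \<A> by (intro image_subsetI Int_in_carrier_free_frame U) blast
    have "U \<sqinter>\<^bsub>free_frame X\<^esub> \<Squnion>\<^bsub>free_frame X\<^esub>\<A> = U \<inter> \<Union>\<A>"
      unfolding Sup_free_frame[OF \<A>]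
      by (rule meet_free_frame[OF U Union_in_carrier_free_frame[OF \<A>]])
    also have "\<dots> = \<Union>((\<lambda>V. U \<inter> V) ` \<A>)"
      by (rule Int_Union)
    also have "\<dots> = \<Squnion>\<^bsub>free_frame X\<^esub>((\<lambda>V. U \<sqinter>\<^bsub>free_frame X\<^esub> V) ` \<A>)"
      unfolding * by (rule Sup_free_frame[OF **, symmetric])
    finally show "U \<sqinter>\<^bsub>free_frame X\<^esub> \<Squnion>\<^bsub>free_frame X\<^esub>\<A> =
        \<Squnion>\<^bsub>free_frame X\<^esub>((\<lambda>V. U \<sqinter>\<^bsub>free_frame X\<^esub> V) ` \<A>)" .
  qed
qed

lemma free_gen_in_carrier: "free_gen X x \<in> carrier (free_frame X)"
  by (auto simp: in_carrier_free_frame_iff free_gen_def)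

lemma (in complete_lattice) Sup_Union:
  assumes "\<And>A. A \<in> \<A> \<Longrightarrow> A \<subseteq> carrier L"
  shows "\<Squnion>(\<Union>\<A>) = \<Squnion>((\<lambda>A. \<Squnion>A) ` \<A>)"
proof -
  let ?s = "\<Squnion>((\<lambda>A. \<Squnion>A) ` \<A>)"
  have c: "\<Union>\<A> \<subseteq> carrier L" "(\<lambda>A. \<Squnion>A) ` \<A> \<subseteq> carrier L"
    using assms by auto
  have cs: "?s \<in> carrier L" by (rule sup_closed[OF c(2)])
  have cu: "\<Squnion>(\<Union>\<A>) \<in> carrier L" by (rule sup_closed[OF c(1)])
  show ?thesis
  proof (rule le_antisym[OF _ _ cu cs])
    show "\<Squnion>(\<Union>\<A>) \<sqsubseteq> ?s"
    proof (rule sup_least[OF c(1) cs])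
      fix y assume "y \<in> \<Union>\<A>"
      then obtain A where A: "A \<in> \<A>" "y \<in> A" by blast
      have "y \<sqsubseteq> \<Squnion>A" by (rule sup_upper[OF assms[OF A(1)] A(2)])
      moreover have "\<Squnion>A \<sqsubseteq> ?s" by (rule sup_upper[OF c(2) imageI[OF A(1)]])
      ultimately show "y \<sqsubseteq> ?s"
        using A assms cs by (meson le_trans sup_closed subsetD)
    qed
    show "?s \<sqsubseteq> \<Squnion>(\<Union>\<A>)"
    proof (rule sup_least[OF c(2) cu])
      fix y assume "y \<in> (\<lambda>A. \<Squnion>A) ` \<A>"
      then obtain A where A: "A \<in> \<A>" "y = \<Squnion>A" by blast
      show "y \<sqsubseteq> \<Squnion>(\<Union>\<A>)"
        unfolding A(2) by (rule sup_least[OF assms[OF A(1)] cu], rule sup_upper[OF c(1)])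
          (use A(1) in blast)
    qed
  qed
qed

lemma (in complete_lattice) Inf_Un:
  assumes A: "A \<subseteq> carrier L" and B: "B \<subseteq> carrier L"
  shows "\<Sqinter>(A \<union> B) = \<Sqinter>A \<sqinter> \<Sqinter>B"
proof (rule meet_eqI[symmetric])
  have AB: "A \<union> B \<subseteq> carrier L" using assms by blast
  then show cAB: "\<Sqinter>(A \<union> B) \<in> carrier L" by (rule inf_closed)
  show "\<Sqinter>(A \<union> B) \<sqsubseteq> \<Sqinter>A"
    by (rule inf_greatest[OF A cAB], rule inf_lower[OF AB]) blast
  show "\<Sqinter>(A \<union> B) \<sqsubseteq> \<Sqinter>B"
    by (rule inf_greatest[OF B cAB], rule inf_lower[OF AB]) blast
  fix w assume w: "w \<in> carrier L" "w \<sqsubseteq> \<Sqinter>A" "w \<sqsubseteq> \<Sqinter>B"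
  show "w \<sqsubseteq> \<Sqinter>(A \<union> B)"
  proof (rule inf_greatest[OF AB w(1)])
    fix x assume "x \<in> A \<union> B"
    then show "w \<sqsubseteq> x"
    proof
      assume x: "x \<in> A"
      show ?thesis
        by (rule le_trans[OF w(2) inf_lower[OF A x] w(1) inf_closed[OF A]]) (use x A in blast)
    next
      assume x: "x \<in> B"
      show ?thesis
        by (rule le_trans[OF w(3) inf_lower[OF B x] w(1) inf_closed[OF B]]) (use x B in blast)
    qed
  qed
qed (rule inf_closed[OF A], rule inf_closed[OF B])

lemma (in complete_lattice) meet_comm: "x \<sqinter> y = y \<sqinter> x"
  by (simp add: meet_def insert_commute)

theorem free_frame_universal:
  assumes "frame M" and f: "f \<in> X \<rightarrow> carrier M"
  shows "\<exists>h. frame_hom (free_frame X) M h \<and> (\<forall>x\<in>X. h (free_gen X x) = f x) \<and>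
    (\<forall>h'. frame_hom (free_frame X) M h' \<and> (\<forall>x\<in>X. h' (free_gen X x) = f x) \<longrightarrow>
      (\<forall>U\<in>carrier (free_frame X). h' U = h U))"
proof -
  interpret M: frame M by fact
  let ?FX = "free_frame X"
  interpret F: frame ?FX by (rule frame_free_frame)
  define m where "m F = \<Sqinter>\<^bsub>M\<^esub>(f ` F)" for F
  define h where "h U = \<Squnion>\<^bsub>M\<^esub>(m ` U)" for U
  define up where "up F = {G. finite G \<and> F \<subseteq> G \<and> G \<subseteq> X}" for F
  have fc: "f ` F \<subseteq> carrier M" if "F \<subseteq> X" for F using f that by auto
  have mc: "m F \<in> carrier M" if "F \<subseteq> X" for F using fc[OF that] by (simp add: m_def)
  have Ucl: "m ` U \<subseteq> carrier M" if "U \<in> carrier ?FX" for U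
    using that mc by (auto simp: in_carrier_free_frame_iff)
  have hc: "h U \<in> carrier M" if "U \<in> carrier ?FX" for U
    using Ucl[OF that] by (simp add: h_def)
  have m_anti: "m G \<sqsubseteq>\<^bsub>M\<^esub> m F" if "F \<subseteq> G" "G \<subseteq> X" for F G
    unfolding m_def using fc[of F] fc[of G] that
    by (intro M.inf_greatest Lower_memI M.inf_lower) auto
  have m_Un: "m (F \<union> G) = m F \<sqinter>\<^bsub>M\<^esub> m G" if "F \<subseteq> X" "G \<subseteq> X" for F G
    using that fc by (simp add: m_def image_Un M.Inf_Un)
  have m_empty: "m {} = \<top>\<^bsub>M\<^esub>"
    unfolding m_def by (rule M.top_eqI[symmetric]) (auto intro: M.inf_greatest)
  have m_single: "m {x} = f x" if "x \<in> X" for x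
    unfolding m_def using f that
    by (intro M.Inf_eqI greatest_LowerI) (auto simp: Lower_def)
  have upc: "up F \<in> carrier ?FX" for F
    by (auto simp: in_carrier_free_frame_iff up_def)
  have h_up: "h (up F) = m F" if "finite F" "F \<subseteq> X" for F
    unfolding h_def
  proof (rule M.Sup_eqI, rule least_UpperI)
    show "y \<sqsubseteq>\<^bsub>M\<^esub> m F" if "y \<in> m ` up F" for y
      using that m_anti by (auto simp: up_def)
    show "m F \<sqsubseteq>\<^bsub>M\<^esub> y" if "y \<in> Upper M (m ` up F)" for y
    proof -
      have "m F \<in> m ` up F"
        using \<open>finite F\<close> \<open>F \<subseteq> X\<close> by (auto simp: up_def)
      then show ?thesis
        using that mc \<open>F \<subseteq> X\<close> unfolding Upper_def by blast
    qed
  qed (use that mc Ucl[OF upc] in auto)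
  have top_up: "\<top>\<^bsub>?FX\<^esub> = up {}"
    by (auto simp: top_free_frame up_def)
  have gen_up: "free_gen X x = up {x}" for x
    by (auto simp: free_gen_def up_def)
  have h_gen: "h (free_gen X x) = f x" if "x \<in> X" for x
    using that by (simp add: gen_up h_up m_single)
  have h_Sup: "h (\<Squnion>\<^bsub>?FX\<^esub>\<A>) = \<Squnion>\<^bsub>M\<^esub>(h ` \<A>)" if "\<A> \<subseteq> carrier ?FX" for \<A>
  proof -
    have "h (\<Squnion>\<^bsub>?FX\<^esub>\<A>) = \<Squnion>\<^bsub>M\<^esub>(\<Union>((\<lambda>U. m ` U) ` \<A>))"
      using that by (simp add: Sup_free_frame h_def image_Union)
    also have "\<dots> = \<Squnion>\<^bsub>M\<^esub>((\<lambda>A. \<Squnion>\<^bsub>M\<^esub>A) ` (\<lambda>U. m ` U) ` \<A>)"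
      by (rule M.Sup_Union) (use that Ucl in blast)
    finally show ?thesis by (simp add: image_image h_def)
  qed
  have h_meet: "h (U \<sqinter>\<^bsub>?FX\<^esub> V) = h U \<sqinter>\<^bsub>M\<^esub> h V"
    if U: "U \<in> carrier ?FX" and V: "V \<in> carrier ?FX" for U V
  proof -
    have FU: "F \<subseteq> X" and finU: "finite F" if "F \<in> U" for F
      using U[unfolded in_carrier_free_frame_iff, THEN conjunct1] that by blast+
    have FV: "F \<subseteq> X" and finV: "finite F" if "F \<in> V" for F
      using V[unfolded in_carrier_free_frame_iff, THEN conjunct1] that by blast+
    have "h U \<sqinter>\<^bsub>M\<^esub> h V = \<Squnion>\<^bsub>M\<^esub>((\<lambda>s. h U \<sqinter>\<^bsub>M\<^esub> s) ` m ` V)"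
      unfolding h_def[of V] by (rule M.meet_Sup_distrib[OF hc[OF U] Ucl[OF V]])
    also have "(\<lambda>s. h U \<sqinter>\<^bsub>M\<^esub> s) ` m ` V = (\<lambda>A. \<Squnion>\<^bsub>M\<^esub>A) ` (\<lambda>G. (\<lambda>F. m (F \<union> G)) ` U) ` V"
      unfolding image_image
    proof (rule image_cong[OF refl])
      fix G assume G: "G \<in> V"
      have "h U \<sqinter>\<^bsub>M\<^esub> m G = m G \<sqinter>\<^bsub>M\<^esub> h U" 
        by (rule M.meet_comm)
      also have "\<dots> = \<Squnion>\<^bsub>M\<^esub>((\<lambda>s. m G \<sqinter>\<^bsub>M\<^esub> s) ` m ` U)"
        unfolding h_def by (rule M.meet_Sup_distrib[OF mc[OF FV[OF G]] Ucl[OF U]])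
      also have "(\<lambda>s. m G \<sqinter>\<^bsub>M\<^esub> s) ` m ` U = (\<lambda>F. m (F \<union> G)) ` U"
        unfolding image_image
        by (rule image_cong[OF refl]) (simp add: m_Un FU FV G Un_commute M.meet_comm)
      finally show "h U \<sqinter>\<^bsub>M\<^esub> m G = \<Squnion>\<^bsub>M\<^esub>((\<lambda>F. m (F \<union> G)) ` U)" .
    qed
    also have "\<Squnion>\<^bsub>M\<^esub>((\<lambda>A. \<Squnion>\<^bsub>M\<^esub>A) ` (\<lambda>G. (\<lambda>F. m (F \<union> G)) ` U) ` V) =
        \<Squnion>\<^bsub>M\<^esub>(\<Union>((\<lambda>G. (\<lambda>F. m (F \<union> G)) ` U) ` V))"
      by (rule M.Sup_Union[symmetric]) (use mc FU FV in auto)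
    also have "\<Union>((\<lambda>G. (\<lambda>F. m (F \<union> G)) ` U) ` V) = m ` (U \<inter> V)"
    proof (intro equalityI subsetI)
      fix y assume "y \<in> \<Union>((\<lambda>G. (\<lambda>F. m (F \<union> G)) ` U) ` V)"
      then obtain F G where FG: "F \<in> U" "G \<in> V" "y = m (F \<union> G)" by blast
      have "finite (F \<union> G)" "F \<union> G \<subseteq> X"
        by (simp_all add: FU FV finU finV FG(1,2))
      then have up: "finite (F \<union> G) \<and> F \<subseteq> F \<union> G \<and> F \<union> G \<subseteq> X"
        "finite (F \<union> G) \<and> G \<subseteq> F \<union> G \<and> F \<union> G \<subseteq> X" by simp_all
      have "F \<union> G \<in> U"
        by (rule U[unfolded in_carrier_free_frame_iff, THEN conjunct2, rule_format, OF FG(1) up(1)])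
      moreover have "F \<union> G \<in> V"
        by (rule V[unfolded in_carrier_free_frame_iff, THEN conjunct2, rule_format, OF FG(2) up(2)])
      ultimately have "F \<union> G \<in> U \<inter> V" by blast
      then show "y \<in> m ` (U \<inter> V)" using FG by blast
    next
      fix y assume "y \<in> m ` (U \<inter> V)"
      then obtain F where F: "F \<in> U" "F \<in> V" "y = m (F \<union> F)" by auto
      show "y \<in> \<Union>((\<lambda>G. (\<lambda>F. m (F \<union> G)) ` U) ` V)"
        unfolding F(3) by (rule UN_I[OF F(2)], rule imageI[OF F(1)])
    qed
    finally show ?thesis using U V by (simp add: meet_free_frame h_def)
  qed
  have h_top: "h \<top>\<^bsub>?FX\<^esub> = \<top>\<^bsub>M\<^esub>"
    by (simp add: top_up h_up m_empty)
  have hom: "frame_hom ?FX M h"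
    unfolding frame_hom_def
    by (intro conjI funcsetI ballI allI impI hc h_top h_meet h_Sup)
  moreover have "h' U = h U"
    if h': "frame_hom ?FX M h'" and h'_gen: "\<forall>x\<in>X. h' (free_gen X x) = f x"
      and U: "U \<in> carrier ?FX" for h' U
  proof -
    have h'_top: "h' \<top>\<^bsub>?FX\<^esub> = \<top>\<^bsub>M\<^esub>"
      using h' unfolding frame_hom_def by (elim conjE)
    have h'_meet: "h' (V \<sqinter>\<^bsub>?FX\<^esub> W) = h' V \<sqinter>\<^bsub>M\<^esub> h' W"
      if "V \<in> carrier ?FX" "W \<in> carrier ?FX" for V W
      using h' that unfolding frame_hom_def by blast
    have h'_Sup: "h' (\<Squnion>\<^bsub>?FX\<^esub>\<A>) = \<Squnion>\<^bsub>M\<^esub>(h' ` \<A>)" if "\<A> \<subseteq> carrier ?FX" for \<A>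
      using h' that unfolding frame_hom_def by blast
    have up: "h' (up F) = m F" if "finite F" "F \<subseteq> X" for F
      using that
    proof (induction F)
      case empty
      then show ?case by (simp add: m_empty h'_top flip: top_up)
    next
      case (insert x F)
      have "up (insert x F) = free_gen X x \<inter> up F"
        by (auto simp: up_def free_gen_def)
      also have "\<dots> = free_gen X x \<sqinter>\<^bsub>?FX\<^esub> up F"
        by (rule meet_free_frame[OF free_gen_in_carrier upc, symmetric])
      finally have "h' (up (insert x F)) = h' (free_gen X x) \<sqinter>\<^bsub>M\<^esub> h' (up F)"
        using h'_meet[OF free_gen_in_carrier upc] by simp
      also have "\<dots> = m {x} \<sqinter>\<^bsub>M\<^esub> m F"
        using insert h'_gen by (simp add: m_single)
      finally show ?case using insert m_Un[of "{x}" F] by simp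
    qed
    have FU: "F \<subseteq> X" and finU: "finite F" if "F \<in> U" for F
      using U[unfolded in_carrier_free_frame_iff, THEN conjunct1] that by blast+
    have "up F \<subseteq> U" if "F \<in> U" for F
      using U[unfolded in_carrier_free_frame_iff, THEN conjunct2, rule_format, OF that]
      unfolding up_def by blast
    moreover have "F \<in> up F" if "F \<in> U" for F
      using FU[OF that] finU[OF that] by (simp add: up_def)
    ultimately have "U = \<Union>(up ` U)" by blast
    also have "\<dots> = \<Squnion>\<^bsub>?FX\<^esub>(up ` U)"
      by (rule Sup_free_frame[symmetric]) (use upc in blast)
    finally have "h' U = h' (\<Squnion>\<^bsub>?FX\<^esub>(up ` U))" by (rule arg_cong)
    also have "\<dots> = \<Squnion>\<^bsub>M\<^esub>(h' ` up ` U)"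
      by (rule h'_Sup) (use upc in blast)
    also have "h' ` up ` U = m ` U"
      unfolding image_image by (rule image_cong[OF refl], rule up[OF finU FU])
    finally show ?thesis by (simp add: h_def)
  qed
  ultimately show ?thesis using h_gen by blast
qed

lemma (in frame) frame_congruence_generated:
  assumes "R \<subseteq> carrier L \<times> carrier L"
  shows "frame_congruence L (generated_congruence L R)"
proof -
  let ?C = "{\<theta>. frame_congruence L \<theta> \<and> R \<subseteq> \<theta>}"
  have "frame_congruence L (carrier L \<times> carrier L)"
    unfolding frame_congruence_def
  proof (intro conjI allI impI)
    show "equiv (carrier L) (carrier L \<times> carrier L)"
      by (auto simp: equiv_def refl_on_def sym_def trans_def)
    fix S assume "S \<subseteq> carrier L \<times> carrier L"
    then have "fst ` S \<subseteq> carrier L" "snd ` S \<subseteq> carrier L" by auto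
    then show "(\<Squnion>(fst ` S), \<Squnion>(snd ` S)) \<in> carrier L \<times> carrier L" by simp
  qed auto
  then have ne: "carrier L \<times> carrier L \<in> ?C" using assms by blast
  have c: "frame_congruence L \<theta>" if "\<theta> \<in> ?C" for \<theta> using that by blast
  show ?thesis
    unfolding generated_congruence_def
  proof (rule frame_congruence_def[THEN iffD2], intro conjI allI impI)
    show "equiv (carrier L) (\<Inter>?C)"
    proof (rule equivI)
      show "\<Inter>?C \<subseteq> carrier L \<times> carrier L" using ne by (rule Inter_lower)
      show "refl_on (carrier L) (\<Inter>?C)"
        using c unfolding frame_congruence_def equiv_def refl_on_def by blast
      show "sym (\<Inter>?C)"
      proof (rule symI)
        fix x y assume "(x, y) \<in> \<Inter>?C"
        then show "(y, x) \<in> \<Inter>?C"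
          using c unfolding frame_congruence_def equiv_def by (meson InterE InterI symD)
      qed
      show "trans (\<Inter>?C)"
      proof (rule transI)
        fix x y z assume "(x, y) \<in> \<Inter>?C" "(y, z) \<in> \<Inter>?C"
        then show "(x, z) \<in> \<Inter>?C"
          using c unfolding frame_congruence_def equiv_def by (meson InterE InterI transD)
      qed
    qed
  next
    fix a b c' d assume "(a, b) \<in> \<Inter>?C \<and> (c', d) \<in> \<Inter>?C"
    then show "(a \<sqinter> c', b \<sqinter> d) \<in> \<Inter>?C"
      using c unfolding frame_congruence_def by (meson InterE InterI)
  next
    fix S assume S: "S \<subseteq> \<Inter>?C"
    show "(\<Squnion>(fst ` S), \<Squnion>(snd ` S)) \<in> \<Inter>?C"
    proof (rule InterI)
      fix \<theta> assume "\<theta> \<in> ?C"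
      moreover from this have "S \<subseteq> \<theta>" using S by blast
      ultimately show "(\<Squnion>(fst ` S), \<Squnion>(snd ` S)) \<in> \<theta>"
        using c unfolding frame_congruence_def by blast
    qed
  qed
qed

lemma generated_congruence_incl: "R \<subseteq> generated_congruence L R"
  by (auto simp: generated_congruence_def)

lemma generated_congruence_least:
  "\<lbrakk>frame_congruence L \<theta>; R \<subseteq> \<theta>\<rbrakk> \<Longrightarrow> generated_congruence L R \<subseteq> \<theta>"
  by (auto simp: generated_congruence_def)

lemma quotient_frame_sel [simp]:
  "carrier (quotient_frame L \<theta>) = carrier L // \<theta>"
  "eq (quotient_frame L \<theta>) = (=)"
  by (simp_all add: quotient_frame_def)

context frame
begin

context
  fixes \<theta> assumes cong: "frame_congruence L \<theta>"
begin

private abbreviation cls where "cls a \<equiv> \<theta> `` {a}"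

lemma cong_equiv: "equiv (carrier L) \<theta>"
  using cong by (simp add: frame_congruence_def)

lemma cong_carrier: "(a, b) \<in> \<theta> \<Longrightarrow> a \<in> carrier L \<and> b \<in> carrier L"
  using cong_equiv by (meson equiv_class_eq_iff)

lemma cong_refl: "a \<in> carrier L \<Longrightarrow> (a, a) \<in> \<theta>"
  using cong_equiv by (auto simp: equiv_def refl_on_def)

lemma cong_sym: "(a, b) \<in> \<theta> \<Longrightarrow> (b, a) \<in> \<theta>"
  using cong_equiv by (meson equivE symD)

lemma cong_trans: "(a, b) \<in> \<theta> \<Longrightarrow> (b, c) \<in> \<theta> \<Longrightarrow> (a, c) \<in> \<theta>"
  using cong_equiv by (meson equivE transD)

lemma cong_meet: "(a, b) \<in> \<theta> \<Longrightarrow> (c, d) \<in> \<theta> \<Longrightarrow> (a \<sqinter> c, b \<sqinter> d) \<in> \<theta>"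
  using cong unfolding frame_congruence_def by metis

lemma cong_Sup:
  assumes "\<And>i. i \<in> J \<Longrightarrow> (f i, g i) \<in> \<theta>"
  shows "(\<Squnion>(f ` J), \<Squnion>(g ` J)) \<in> \<theta>"
proof -
  have "(\<lambda>i. (f i, g i)) ` J \<subseteq> \<theta>" using assms by blast
  then have "(\<Squnion>(fst ` (\<lambda>i. (f i, g i)) ` J), \<Squnion>(snd ` (\<lambda>i. (f i, g i)) ` J)) \<in> \<theta>"
    using cong unfolding frame_congruence_def by blast
  then show ?thesis by (simp add: image_image)
qed

lemma cls_eq_iff: "\<lbrakk>a \<in> carrier L; b \<in> carrier L\<rbrakk> \<Longrightarrow> cls a = cls b \<longleftrightarrow> (a, b) \<in> \<theta>"
  using cong_equiv by (simp add: equiv_class_eq_iff)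

lemma le_quotient_iff:
  assumes a: "a \<in> carrier L" and b: "b \<in> carrier L"
  shows "cls a \<sqsubseteq>\<^bsub>quotient_frame L \<theta>\<^esub> cls b \<longleftrightarrow> (a \<sqinter> b, a) \<in> \<theta>"
proof
  assume "cls a \<sqsubseteq>\<^bsub>quotient_frame L \<theta>\<^esub> cls b"
  then obtain x y where xy: "(a, x) \<in> \<theta>" "(b, y) \<in> \<theta>" "(a, x \<sqinter> y) \<in> \<theta>"
    by (auto simp: quotient_frame_def)
  then show "(a \<sqinter> b, a) \<in> \<theta>" by (meson cong_meet cong_sym cong_trans)
next
  assume "(a \<sqinter> b, a) \<in> \<theta>"
  then have "(a, a \<sqinter> b) \<in> \<theta>" by (rule cong_sym)
  then show "cls a \<sqsubseteq>\<^bsub>quotient_frame L \<theta>\<^esub> cls b"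
    using cong_refl[OF a] cong_refl[OF b] by (auto simp: quotient_frame_def)
qed

lemma carrier_quotientE:
  assumes "A \<in> carrier L // \<theta>"
  obtains a where "a \<in> carrier L" "A = cls a"
  using assms by (auto elim: quotientE)

lemma partial_order_quotient_frame: "partial_order (quotient_frame L \<theta>)"
proof unfold_locales
  let ?Q = "quotient_frame L \<theta>"
  show "A \<sqsubseteq>\<^bsub>?Q\<^esub> A" if A: "A \<in> carrier ?Q" for A
  proof -
    obtain a where a: "a \<in> carrier L" "A = cls a"
      using A unfolding quotient_frame_sel by (rule carrier_quotientE)
    moreover have "a \<sqinter> a = a" using a by (intro meet_eqI) auto
    ultimately show ?thesis by (simp add: le_quotient_iff cong_refl)
  qed
  show "A .=\<^bsub>?Q\<^esub> B" if prems: "A \<sqsubseteq>\<^bsub>?Q\<^esub> B" "B \<sqsubseteq>\<^bsub>?Q\<^esub> A" "A \<in> carrier ?Q" "B \<in> carrier ?Q" for A B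
  proof -
    obtain a where a: "a \<in> carrier L" "A = cls a"
      using prems(3) unfolding quotient_frame_sel by (rule carrier_quotientE)
    obtain b where b: "b \<in> carrier L" "B = cls b"
      using prems(4) unfolding quotient_frame_sel by (rule carrier_quotientE)
    note ab = a b
    from ab have "(a \<sqinter> b, a) \<in> \<theta>" "(a \<sqinter> b, b) \<in> \<theta>"
      using prems by (simp_all add: le_quotient_iff meet_comm[of b a])
    then have "(a, b) \<in> \<theta>" by (meson cong_sym cong_trans)
    then show ?thesis using ab by (simp add: cls_eq_iff)
  qed
  show "A \<sqsubseteq>\<^bsub>?Q\<^esub> C"
    if prems: "A \<sqsubseteq>\<^bsub>?Q\<^esub> B" "B \<sqsubseteq>\<^bsub>?Q\<^esub> C" "A \<in> carrier ?Q" "B \<in> carrier ?Q" "C \<in> carrier ?Q" for A B C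
  proof -
    obtain a where a: "a \<in> carrier L" "A = cls a"
      using prems(3) unfolding quotient_frame_sel by (rule carrier_quotientE)
    obtain b where b: "b \<in> carrier L" "B = cls b"
      using prems(4) unfolding quotient_frame_sel by (rule carrier_quotientE)
    obtain c where c: "c \<in> carrier L" "C = cls c"
      using prems(5) unfolding quotient_frame_sel by (rule carrier_quotientE)
    note abc = a b c
    from abc have 1: "(a \<sqinter> b, a) \<in> \<theta>" and 2: "(b \<sqinter> c, b) \<in> \<theta>"
      using prems by (simp_all add: le_quotient_iff)
    have "(a \<sqinter> c, (a \<sqinter> b) \<sqinter> c) \<in> \<theta>"
      using 1 abc by (meson cong_meet cong_sym cong_refl)
    moreover have "(a \<sqinter> b) \<sqinter> c = a \<sqinter> (b \<sqinter> c)"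
      using abc meet_assoc by simp
    moreover have "(a \<sqinter> (b \<sqinter> c), a \<sqinter> b) \<in> \<theta>"
      using 2 abc by (meson cong_meet cong_refl)
    ultimately have "(a \<sqinter> c, a) \<in> \<theta>" using 1 by (metis cong_trans)
    then show ?thesis using abc by (simp add: le_quotient_iff)
  qed
qed simp_all

lemma is_lub_quotient_frame:
  assumes S: "S \<subseteq> carrier L"
  shows "is_lub (quotient_frame L \<theta>) (cls (\<Squnion>S)) (cls ` S)"
proof (rule least_UpperI)
  let ?Q = "quotient_frame L \<theta>"
  have s: "\<Squnion>S \<in> carrier L" using S by simp
  show "cls ` S \<subseteq> carrier ?Q" "cls (\<Squnion>S) \<in> carrier ?Q"
    using S s by (auto intro: quotientI)
  show "A \<sqsubseteq>\<^bsub>?Q\<^esub> cls (\<Squnion>S)" if A: "A \<in> cls ` S" for A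
  proof -
    obtain a where a: "a \<in> S" "A = cls a" using A by blast
    then have ac: "a \<in> carrier L" using S by blast
    have "a \<sqinter> \<Squnion>S = a"
      using sup_upper[OF S a(1)] ac s by (intro meet_eqI) auto
    then show ?thesis using a(2) ac s by (simp add: le_quotient_iff cong_refl)
  qed
  show "cls (\<Squnion>S) \<sqsubseteq>\<^bsub>?Q\<^esub> U" if "U \<in> Upper ?Q (cls ` S)" for U
  proof -
    have "U \<in> carrier L // \<theta>" using that by (simp add: Upper_def)
    then obtain u where u: "u \<in> carrier L" "U = cls u" by (rule carrier_quotientE)
    have "(u \<sqinter> a, a) \<in> \<theta>" if "a \<in> S" for a
    proof -
      have ac: "a \<in> carrier L" using S \<open>a \<in> S\<close> by blast
      then have "cls a \<in> carrier ?Q" by (simp add: quotientI)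
      then have "cls a \<sqsubseteq>\<^bsub>?Q\<^esub> cls u"
        using \<open>U \<in> Upper ?Q (cls ` S)\<close> \<open>a \<in> S\<close> u(2) unfolding Upper_def by blast
      then show ?thesis using ac u(1) by (simp add: le_quotient_iff meet_comm[of u a])
    qed
    then have "(\<Squnion>((\<lambda>a. u \<sqinter> a) ` S), \<Squnion>((\<lambda>a. a) ` S)) \<in> \<theta>"
      by (rule cong_Sup)
    then have "(\<Squnion>S \<sqinter> u, \<Squnion>S) \<in> \<theta>"
      using meet_Sup_distrib[OF u(1) S] by (simp add: meet_comm[of _ u])
    then show ?thesis using u s by (simp add: le_quotient_iff)
  qed
qed

lemma quotient_subset_imageE:
  assumes "\<A> \<subseteq> carrier L // \<theta>"
  obtains S where "S \<subseteq> carrier L" "\<A> = cls ` S"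
proof
  show "{a \<in> carrier L. cls a \<in> \<A>} \<subseteq> carrier L" by blast
  show "\<A> = cls ` {a \<in> carrier L. cls a \<in> \<A>}"
    using assms by (auto elim!: quotientE)
qed

lemma complete_lattice_quotient_frame: "complete_lattice (quotient_frame L \<theta>)"
proof (rule complete_latticeI_Sup[OF partial_order_quotient_frame])
  fix \<A> assume \<A>: "\<A> \<subseteq> carrier (quotient_frame L \<theta>)"
  obtain S where "S \<subseteq> carrier L" "\<A> = cls ` S"
    using \<A> unfolding quotient_frame_sel by (rule quotient_subset_imageE)
  then show "\<exists>s. is_lub (quotient_frame L \<theta>) s \<A>"
    using is_lub_quotient_frame by blast
qed

lemma frame_hom_quotient: "frame_hom L (quotient_frame L \<theta>) (\<lambda>a. \<theta> `` {a})"
proof -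
  let ?Q = "quotient_frame L \<theta>"
  interpret Q: complete_lattice ?Q by (rule complete_lattice_quotient_frame)
  have cc: "cls a \<in> carrier ?Q" if "a \<in> carrier L" for a using that by (simp add: quotientI)
  have mono: "cls a \<sqsubseteq>\<^bsub>?Q\<^esub> cls b" if "a \<sqsubseteq> b" "a \<in> carrier L" "b \<in> carrier L" for a b
  proof -
    have "a \<sqinter> b = a" using that by (intro meet_eqI) auto
    then show ?thesis using that by (simp add: le_quotient_iff cong_refl)
  qed
  show ?thesis
    unfolding frame_hom_def
  proof (intro conjI ballI allI impI)
    show "cls \<in> carrier L \<rightarrow> carrier ?Q" using cc by blast
    show "cls \<top> = \<top>\<^bsub>?Q\<^esub>"
    proof (rule Q.top_eqI[symmetric])
      fix A assume "A \<in> carrier ?Q"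
      then obtain a where "a \<in> carrier L" "A = cls a"
        unfolding quotient_frame_sel by (rule carrier_quotientE)
      then show "A \<sqsubseteq>\<^bsub>?Q\<^esub> cls \<top>" using mono top_higher top_closed by blast
    qed (rule cc[OF top_closed])
    show "cls (\<Squnion>S) = \<Squnion>\<^bsub>?Q\<^esub>(cls ` S)" if "S \<subseteq> carrier L" for S
      by (rule Q.Sup_eqI[OF is_lub_quotient_frame[OF that], symmetric])
    fix a b assume a: "a \<in> carrier L" and b: "b \<in> carrier L"
    have ab: "a \<sqinter> b \<in> carrier L" using a b by simp
    show "cls (a \<sqinter> b) = cls a \<sqinter>\<^bsub>?Q\<^esub> cls b"
    proof (rule Q.meet_eqI[OF cc[OF a] cc[OF b] cc[OF ab], symmetric])
      show "cls (a \<sqinter> b) \<sqsubseteq>\<^bsub>?Q\<^esub> cls a" "cls (a \<sqinter> b) \<sqsubseteq>\<^bsub>?Q\<^esub> cls b"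
        using a b ab meet_left meet_right by (auto intro: mono)
      fix W assume W: "W \<in> carrier ?Q" "W \<sqsubseteq>\<^bsub>?Q\<^esub> cls a" "W \<sqsubseteq>\<^bsub>?Q\<^esub> cls b"
      obtain w where w: "w \<in> carrier L" "W = cls w"
        using W(1) unfolding quotient_frame_sel by (rule carrier_quotientE)
      have 1: "(w \<sqinter> a, w) \<in> \<theta>" and 2: "(w \<sqinter> b, w) \<in> \<theta>"
        using W w a b by (simp_all add: le_quotient_iff)
      have "((w \<sqinter> a) \<sqinter> b, w \<sqinter> b) \<in> \<theta>" using 1 b by (meson cong_meet cong_refl)
      moreover have "(w \<sqinter> a) \<sqinter> b = w \<sqinter> (a \<sqinter> b)" using w a b meet_assoc by simp
      ultimately have "(w \<sqinter> (a \<sqinter> b), w) \<in> \<theta>" using 2 by (metis cong_trans)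
      then show "W \<sqsubseteq>\<^bsub>?Q\<^esub> cls (a \<sqinter> b)" using w ab by (simp add: le_quotient_iff)
    qed
  qed
qed

lemma frame_quotient_frame: "frame (quotient_frame L \<theta>)"
proof -
  let ?Q = "quotient_frame L \<theta>"
  interpret Q: complete_lattice ?Q by (rule complete_lattice_quotient_frame)
  have hm: "cls a \<sqinter>\<^bsub>?Q\<^esub> cls b = cls (a \<sqinter> b)" if "a \<in> carrier L" "b \<in> carrier L" for a b
    using frame_hom_quotient that by (simp add: frame_hom_def)
  have hs: "\<Squnion>\<^bsub>?Q\<^esub>(cls ` S) = cls (\<Squnion>S)" if "S \<subseteq> carrier L" for S
    using frame_hom_quotient that by (simp add: frame_hom_def)
  show ?thesis
  proof
    fix A \<S> assume A: "A \<in> carrier ?Q" and \<S>: "\<S> \<subseteq> carrier ?Q"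
    obtain a where a: "a \<in> carrier L" "A = cls a"
      using A unfolding quotient_frame_sel by (rule carrier_quotientE)
    obtain S where S: "S \<subseteq> carrier L" "\<S> = cls ` S"
      using \<S> unfolding quotient_frame_sel by (rule quotient_subset_imageE)
    have aS: "(\<lambda>s. a \<sqinter> s) ` S \<subseteq> carrier L" using a S by auto
    have "A \<sqinter>\<^bsub>?Q\<^esub> \<Squnion>\<^bsub>?Q\<^esub>\<S> = cls (a \<sqinter> \<Squnion>S)"
      using a S by (simp add: hs hm)
    also have "\<dots> = \<Squnion>\<^bsub>?Q\<^esub>(cls ` (\<lambda>s. a \<sqinter> s) ` S)"
      unfolding meet_Sup_distrib[OF a(1) S(1)] by (rule hs[OF aS, symmetric])
    also have "cls ` (\<lambda>s. a \<sqinter> s) ` S = (\<lambda>s. A \<sqinter>\<^bsub>?Q\<^esub> s) ` \<S>"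
      unfolding image_image S(2) a(2)
      by (rule image_cong[OF HOL.refl], rule hm[symmetric]) (use a S in auto)
    finally show "A \<sqinter>\<^bsub>?Q\<^esub> \<Squnion>\<^bsub>?Q\<^esub>\<S> = \<Squnion>\<^bsub>?Q\<^esub>((\<lambda>s. A \<sqinter>\<^bsub>?Q\<^esub> s) ` \<S>)" .
  qed
qed

end

end

theorem (in frame) quotient_frame_universal:
  assumes R: "R \<subseteq> carrier L \<times> carrier L" and "frame M" and h: "frame_hom L M h"
    and hR: "\<And>a b. (a, b) \<in> R \<Longrightarrow> h a = h b"
  shows "\<exists>k. frame_hom (quotient_frame L (generated_congruence L R)) M k \<and>
    (\<forall>a\<in>carrier L. k (generated_congruence L R `` {a}) = h a)"
proof -
  interpret M: frame M by fact
  define \<theta> where "\<theta> = generated_congruence L R"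
  let ?Q = "quotient_frame L \<theta>" and ?cls = "\<lambda>a. \<theta> `` {a}"
  have \<theta>: "frame_congruence L \<theta>"
    unfolding \<theta>_def by (rule frame_congruence_generated[OF R])
  have h_top: "h \<top> = \<top>\<^bsub>M\<^esub>"
    using h unfolding frame_hom_def by (elim conjE)
  have h_car: "h a \<in> carrier M" if "a \<in> carrier L" for a
    using h that unfolding frame_hom_def by blast
  have h_meet: "h (a \<sqinter> b) = h a \<sqinter>\<^bsub>M\<^esub> h b" if "a \<in> carrier L" "b \<in> carrier L" for a b
    using h that unfolding frame_hom_def by blast
  have h_Sup: "h (\<Squnion>S) = \<Squnion>\<^bsub>M\<^esub>(h ` S)" if "S \<subseteq> carrier L" for S
    using h that unfolding frame_hom_def by blast
  define K where "K = {(a, b). a \<in> carrier L \<and> b \<in> carrier L \<and> h a = h b}"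
  have "frame_congruence L K"
    unfolding frame_congruence_def
  proof (intro conjI allI impI)
    show "equiv (carrier L) K"
      by (rule equivI) (auto simp: K_def refl_on_def sym_def trans_def)
    show "(a \<sqinter> c, b \<sqinter> d) \<in> K" if "(a, b) \<in> K \<and> (c, d) \<in> K" for a b c d
      using that by (simp add: K_def h_meet)
    fix S assume S: "S \<subseteq> K"
    then have "fst ` S \<subseteq> carrier L" "snd ` S \<subseteq> carrier L" by (auto simp: K_def)
    moreover have "h ` fst ` S = h ` snd ` S"
      unfolding image_image by (rule image_cong[OF HOL.refl]) (use S in \<open>auto simp: K_def\<close>)
    ultimately show "(\<Squnion>(fst ` S), \<Squnion>(snd ` S)) \<in> K" by (simp add: K_def h_Sup)
  qed
  moreover have "R \<subseteq> K" using R hR by (auto simp: K_def)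
  ultimately have \<theta>K: "\<theta> \<subseteq> K"
    unfolding \<theta>_def by (rule generated_congruence_least)
  define k where "k A = h (SOME a. a \<in> A)" for A
  have k: "k (?cls a) = h a" if "a \<in> carrier L" for a
  proof -
    have "(SOME b. b \<in> ?cls a) \<in> ?cls a"
      by (rule someI[of _ a]) (simp add: cong_refl[OF \<theta> that])
    then show ?thesis using \<theta>K by (auto simp: k_def K_def)
  qed
  have q: "frame_hom L ?Q ?cls" by (rule frame_hom_quotient[OF \<theta>])
  have "frame_hom ?Q M k"
    unfolding frame_hom_def
  proof (intro conjI funcsetI ballI allI impI)
    fix A assume "A \<in> carrier ?Q"
    then obtain a where a: "a \<in> carrier L" "A = ?cls a"
      unfolding quotient_frame_sel by (rule carrier_quotientE[OF \<theta>])
    then show "k A \<in> carrier M" by (simp add: k h_car)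
    fix B assume "B \<in> carrier ?Q"
    then obtain b where b: "b \<in> carrier L" "B = ?cls b"
      unfolding quotient_frame_sel by (rule carrier_quotientE[OF \<theta>])
    have "A \<sqinter>\<^bsub>?Q\<^esub> B = ?cls (a \<sqinter> b)"
      using q a b by (simp add: frame_hom_def)
    then show "k (A \<sqinter>\<^bsub>?Q\<^esub> B) = k A \<sqinter>\<^bsub>M\<^esub> k B"
      using a b by (simp add: k h_meet)
  next
    have "\<top>\<^bsub>?Q\<^esub> = ?cls \<top>" using q by (simp add: frame_hom_def)
    then show "k \<top>\<^bsub>?Q\<^esub> = \<top>\<^bsub>M\<^esub>" by (simp add: k h_top)
  next
    fix \<S> assume "\<S> \<subseteq> carrier ?Q"
    then obtain S where S: "S \<subseteq> carrier L" "\<S> = ?cls ` S"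
      unfolding quotient_frame_sel by (rule quotient_subset_imageE[OF \<theta>])
    have "\<Squnion>\<^bsub>?Q\<^esub>\<S> = ?cls (\<Squnion>S)" using q S by (simp add: frame_hom_def)
    then have "k (\<Squnion>\<^bsub>?Q\<^esub>\<S>) = \<Squnion>\<^bsub>M\<^esub>(h ` S)" using S by (simp add: k h_Sup)
    also have "h ` S = k ` \<S>"
      unfolding S(2) image_image by (rule image_cong[OF HOL.refl]) (use S in \<open>auto simp: k\<close>)
    finally show "k (\<Squnion>\<^bsub>?Q\<^esub>\<S>) = \<Squnion>\<^bsub>M\<^esub>(k ` \<S>)" .
  qed
  then show ?thesis using k unfolding \<theta>_def by blast
qed

theorem frame_presented_frame:
  assumes "R \<subseteq> carrier (free_frame X) \<times> carrier (free_frame X)"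
  shows "frame (presented_frame X R)"
proof -
  interpret frame "free_frame X" by (rule frame_free_frame)
  show ?thesis
    unfolding presented_frame_def
    by (rule frame_quotient_frame[OF frame_congruence_generated[OF assms]])
qed

end

theory Submission
  imports Defs
begin

text \<open>
  If the join of a complete lattice is jointly Scott continuous, then irreducible closed sets are
  directed, so they contain their suprema and are principal. Joint continuity holds because countably
  presented frames are frames of opens of quasi-Polish spaces, which are consonant. Without
  mentioning points: a point is built by a tree of finite approximations \<open>s\<close>, each standing for
  an element \<open>val s\<close> that is the join of the values of its children, and every infinite branch is
  a completely prime filter, since it serves each of the countably many relations. Given
  \<open>x \<squnion> y \<in> U\<close> one chooses finite levels of nodes below \<open>x\<close> and below \<open>y\<close> whose joint
  supremum stays in \<open>U\<close>; by Koenig's lemma, the elements above some level on either side form a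
  Scott-open set. Such trees exist for arbitrary products, by taking the disjoint union.
\<close>

section \<open>Koenig's lemma for level sequences\<close>

text \<open>An \<open>E\<close>-path of length \<open>j\<close> starts at \<open>s\<close> and runs
  through the sets \<open>B k\<close> to \<open>B (k + j)\<close>. The level is a separate argument
  because the sets \<open>B k\<close> may overlap.\<close>

primrec extendable :: "(nat \<Rightarrow> 'n set) \<Rightarrow> ('n \<Rightarrow> 'n \<Rightarrow> bool) \<Rightarrow> nat \<Rightarrow> nat \<Rightarrow> 'n \<Rightarrow> bool" where
  "extendable B E 0 k s \<longleftrightarrow> s \<in> B k"
| "extendable B E (Suc j) k s \<longleftrightarrow> s \<in> B k \<and> (\<exists>t. E s t \<and> extendable B E j (Suc k) t)"

lemma extendable_mem: "extendable B E j k s \<Longrightarrow> s \<in> B k"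
  by (cases j) auto

lemma extendable_antimono: "extendable B E j k s \<Longrightarrow> i \<le> j \<Longrightarrow> extendable B E i k s"
proof (induction j arbitrary: i k s)
  case (Suc j)
  then show ?case by (cases i) auto
qed simp

text \<open>Prepending predecessors gives paths of every finite length from each level. By
  finiteness one node starts paths of all lengths, and it has a successor of the same kind, so
  dependent choice yields the branch.\<close>

lemma koenig:
  assumes fin: "\<And>k. finite (B k)" and ne: "\<And>k. B k \<noteq> {}"
    and pred: "\<And>k t. t \<in> B (Suc k) \<Longrightarrow> \<exists>s\<in>B k. E s t"
  obtains b where "\<And>k. b k \<in> B k" "\<And>k. E (b k) (b (Suc k))"
proof -
  have uniform: "\<exists>s. Q s \<and> (\<forall>j. extendable B E j k s)"
    if ex: "\<And>j. \<exists>s. Q s \<and> extendable B E j k s" for k Q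
  proof (rule ccontr)
    assume "\<not> ?thesis"
    then obtain f where f: "\<And>s. Q s \<Longrightarrow> \<not> extendable B E (f s) k s" by metis
    obtain s where s: "Q s" "extendable B E (Max (f ` B k)) k s" using ex by blast
    have "f s \<le> Max (f ` B k)"
      using extendable_mem[OF s(2)] fin by auto
    then show False using f s extendable_antimono by metis
  qed
  have "\<exists>s. extendable B E j k s" for j k
  proof (induction j arbitrary: k)
    case 0
    then show ?case using ne by auto
  next
    case (Suc j)
    then show ?case using pred extendable_mem by (metis extendable.simps(2))
  qed
  then have start: "\<exists>s. \<forall>j. extendable B E j 0 s" using uniform[of "\<lambda>_. True"] by blast
  have step: "\<exists>t. (\<forall>j. extendable B E j (Suc k) t) \<and> E s t" if "\<forall>j. extendable B E j k s" for k s
    using uniform[of "E s" "Suc k"] that by (metis extendable.simps(2))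
  obtain b where "\<And>k. (\<forall>j. extendable B E j k (b k)) \<and> E (b k) (b (Suc k))"
    using dependent_nat_choice[of "\<lambda>k s. \<forall>j. extendable B E j k s" "\<lambda>k. E", OF start step] by blast
  then show thesis using that extendable_mem by metis
qed

section \<open>Scott-open sets and joins\<close>

lemma is_lub_iff:
  assumes "A \<subseteq> carrier L"
  shows "is_lub L x A \<longleftrightarrow> x \<in> carrier L \<and> (\<forall>a\<in>A. a \<sqsubseteq>\<^bsub>L\<^esub> x) \<and>
    (\<forall>u\<in>carrier L. (\<forall>a\<in>A. a \<sqsubseteq>\<^bsub>L\<^esub> u) \<longrightarrow> x \<sqsubseteq>\<^bsub>L\<^esub> u)"
  using assms unfolding least_def Upper_def by blast

locale plain_complete_lattice = complete_lattice L for L :: "'a gorder" (structure)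
begin

lemma scott_open_upper:
  "scott_open L U \<Longrightarrow> x \<in> U \<Longrightarrow> x \<sqsubseteq> y \<Longrightarrow> y \<in> carrier L \<Longrightarrow> y \<in> U"
  unfolding scott_open_def by blast

lemma scott_open_meets:
  "\<lbrakk>scott_open L U; directed_in L D; is_lub L s D; s \<in> U\<rbrakk> \<Longrightarrow> D \<inter> U \<noteq> {}"
  unfolding scott_open_def by (elim conjE allE) (rule mp, assumption, intro conjI)

text \<open>The joins of finite subsets of \<open>S\<close> form a directed set whose supremum is
  the join of \<open>S\<close>.\<close>

lemma scott_open_finite_Sup:
  assumes U: "scott_open L U" and S: "S \<subseteq> carrier L" and "\<Squnion>S \<in> U"
  obtains T where "finite T" "T \<subseteq> S" "\<Squnion>T \<in> U"
proof -
  let ?D = "{\<Squnion>T | T. finite T \<and> T \<subseteq> S}"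
  have c: "T \<subseteq> carrier L" if "T \<subseteq> S" for T using that S by blast
  have Dc: "?D \<subseteq> carrier L" using c by auto
  have "directed_in L ?D"
    unfolding directed_in_def
  proof (intro conjI ballI Dc)
    show "?D \<noteq> {}" by blast
    fix x y assume "x \<in> ?D" "y \<in> ?D"
    then obtain T T' where T: "finite T" "T \<subseteq> S" "x = \<Squnion>T" and T': "finite T'" "T' \<subseteq> S" "y = \<Squnion>T'"
      by blast
    then have cT: "T \<subseteq> carrier L" "T' \<subseteq> carrier L" "T \<union> T' \<subseteq> carrier L" using c by auto
    have "x \<sqsubseteq> \<Squnion>(T \<union> T')" "y \<sqsubseteq> \<Squnion>(T \<union> T')"
      unfolding T(3) T'(3)
      by (rule sup_least[OF cT(1) sup_closed[OF cT(3)]], rule sup_upper[OF cT(3)], simp,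
          rule sup_least[OF cT(2) sup_closed[OF cT(3)]], rule sup_upper[OF cT(3)], simp)
    moreover have "\<Squnion>(T \<union> T') \<in> ?D" using T T' by blast
    ultimately show "\<exists>z\<in>?D. x \<sqsubseteq> z \<and> y \<sqsubseteq> z" by blast
  qed
  moreover have "is_lub L (\<Squnion>S) ?D"
    unfolding is_lub_iff[OF Dc]
  proof (intro conjI ballI impI)
    show "\<Squnion>S \<in> carrier L" using S by simp
    show "x \<sqsubseteq> \<Squnion>S" if x: "x \<in> ?D" for x
    proof -
      obtain T where T: "T \<subseteq> S" "x = \<Squnion>T" using x by blast
      show ?thesis
        unfolding T(2) using T(1) by (intro sup_least[OF c[OF T(1)] sup_closed[OF S]] sup_upper[OF S]) blast
    qed
    fix u assume u: "u \<in> carrier L" "\<forall>a\<in>?D. a \<sqsubseteq> u"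
    show "\<Squnion>S \<sqsubseteq> u"
    proof (rule sup_least[OF S u(1)])
      fix s assume s: "s \<in> S"
      then have "\<Squnion>{s} \<sqsubseteq> u" using u(2) by blast
      moreover have "s \<sqsubseteq> \<Squnion>{s}" using s S by (intro sup_upper) auto
      ultimately show "s \<sqsubseteq> u" using s S u(1) by (meson c empty_subsetI insert_subset le_trans subsetD sup_closed)
    qed
  qed
  ultimately have "?D \<inter> U \<noteq> {}" by (rule scott_open_meets[OF U _ _ assms(3)])
  then show thesis using that by blast
qed

section \<open>Point closures and the T0 axiom\<close>

lemma scott_open_not_le:
  assumes x: "x \<in> carrier L"
  shows "scott_open L {y \<in> carrier L. \<not> y \<sqsubseteq> x}"
  unfolding scott_open_def
proof (intro conjI ballI allI impI)
  fix y z assume "y \<in> {y \<in> carrier L. \<not> y \<sqsubseteq> x}" "z \<in> carrier L" "y \<sqsubseteq> z"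
  then show "z \<in> {y \<in> carrier L. \<not> y \<sqsubseteq> x}" using x le_trans by blast
next
  fix D s assume *: "directed_in L D \<and> is_lub L s D \<and> s \<in> {y \<in> carrier L. \<not> y \<sqsubseteq> x}"
  then have D: "D \<subseteq> carrier L" by (simp add: directed_in_def)
  have "is_lub L s D" "\<not> s \<sqsubseteq> x" using * by simp_all
  then have "\<not> (\<forall>d\<in>D. d \<sqsubseteq> x)" using x unfolding is_lub_iff[OF D] by blast
  then show "D \<inter> {y \<in> carrier L. \<not> y \<sqsubseteq> x} \<noteq> {}" using D by blast
qed simp

text \<open>The elements not below \<open>x\<close> form an open set that misses \<open>x\<close>,
  while an open neighbourhood of an element below \<open>x\<close> contains \<open>x\<close> because
  open sets are upper sets.\<close>

lemma scott_closure_of_singleton: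
  assumes x: "x \<in> carrier L"
  shows "scott_topology L closure_of {x} = {y \<in> carrier L. y \<sqsubseteq> x}"
proof (intro equalityI subsetI)
  fix y assume "y \<in> scott_topology L closure_of {x}"
  then have "y \<in> carrier L" and "scott_open L T \<Longrightarrow> y \<in> T \<Longrightarrow> x \<in> T" for T
    by (simp_all add: in_closure_of)
  then have "y \<sqsubseteq> x" 
    using scott_open_not_le[OF x] le_refl[OF x] by (metis (no_types, lifting) mem_Collect_eq)
  then show "y \<in> {y \<in> carrier L. y \<sqsubseteq> x}" using \<open>y \<in> carrier L\<close> by simp
next
  fix y assume "y \<in> {y \<in> carrier L. y \<sqsubseteq> x}"
  then have y: "y \<in> carrier L" "y \<sqsubseteq> x" by simp_all
  have "x \<in> T" if "scott_open L T" "y \<in> T" for T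
    by (rule scott_open_upper[OF that y(2) x])
  then show "y \<in> scott_topology L closure_of {x}"
    using y by (simp add: in_closure_of)
qed

lemma t0_space_scott_topology: "t0_space (scott_topology L)"
  unfolding t0_space_def
proof (intro ballI impI)
  fix x y assume xy: "x \<in> topspace (scott_topology L)" "y \<in> topspace (scott_topology L)" "x \<noteq> y"
  then have c: "x \<in> carrier L" "y \<in> carrier L" by simp_all
  let ?U = "\<lambda>x. {z \<in> carrier L. \<not> z \<sqsubseteq> x}"
  have o: "openin (scott_topology L) (?U x)" "openin (scott_topology L) (?U y)"
    using c scott_open_not_le by simp_all
  have "\<not> x \<sqsubseteq> y \<or> \<not> y \<sqsubseteq> x" using c xy(3) le_antisym by blast
  then show "\<exists>U. openin (scott_topology L) U \<and> (x \<notin> U) = (y \<in> U)"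
  proof
    assume "\<not> x \<sqsubseteq> y"
    then have "(x \<notin> ?U y) = (y \<in> ?U y)" using c by simp
    then show ?thesis using o(2) by blast
  next
    assume "\<not> y \<sqsubseteq> x"
    then have "(x \<notin> ?U x) = (y \<in> ?U x)" using c by simp
    then show ?thesis using o(1) by blast
  qed
qed

text \<open>
  Joint continuity of the join makes an irreducible closed set \<open>C\<close> directed: if \<open>x \<squnion> y\<close> were
  in the complement of \<open>C\<close>, then so would be \<open>z = z \<squnion> z\<close> for some \<open>z \<in> C\<close> close to both
  \<open>x\<close> and \<open>y\<close>.
\<close>

lemma sober_scott_topology_if_join_continuous:
  assumes join: "\<And>U x y. scott_open L U \<Longrightarrow> x \<in> carrier L \<Longrightarrow> y \<in> carrier L \<Longrightarrow> x \<squnion> y \<in> U \<Longrightarrow>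
    \<exists>V W. scott_open L V \<and> scott_open L W \<and> x \<in> V \<and> y \<in> W \<and> (\<forall>v\<in>V. \<forall>w\<in>W. v \<squnion> w \<in> U)"
  shows "sober_space (scott_topology L)"
  unfolding sober_space_def
proof (intro conjI allI impI t0_space_scott_topology)
  let ?T = "scott_topology L"
  fix C assume C: "irreducible_closedin ?T C"
  then have Cc: "C \<subseteq> carrier L" and open_C: "scott_open L (carrier L - C)"
    by (auto simp: irreducible_closedin_def closedin_def)
  have ne: "C \<noteq> {}" using C by (simp add: irreducible_closedin_def)
  \<comment> \<open>Irreducibility in terms of complements: two open sets that meet \<open>C\<close>
    also meet each other inside \<open>C\<close>.\<close>
  have meets: "V \<inter> W \<inter> C \<noteq> {}"
    if V: "scott_open L V" "V \<inter> C \<noteq> {}" and W: "scott_open L W" "W \<inter> C \<noteq> {}" for V W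
  proof
    assume "V \<inter> W \<inter> C = {}"
    then have "C \<subseteq> (carrier L - V) \<union> (carrier L - W)" using Cc by blast
    moreover have "closedin ?T (carrier L - V)" "closedin ?T (carrier L - W)"
      using V(1) W(1) openin_closedin_eq[of ?T] by simp_all
    ultimately have "C \<subseteq> carrier L - V \<or> C \<subseteq> carrier L - W"
      using C unfolding irreducible_closedin_def by blast
    then show False using V(2) W(2) by blast
  qed
  have join_C: "x \<squnion> y \<in> C" if x: "x \<in> C" and y: "y \<in> C" for x y
  proof (rule ccontr)
    assume "x \<squnion> y \<notin> C"
    moreover have c: "x \<in> carrier L" "y \<in> carrier L" using x y Cc by blast+
    ultimately have "x \<squnion> y \<in> carrier L - C" by simp
    from join[OF open_C c this] obtain V W where "scott_open L V" "scott_open L W" "x \<in> V" "y \<in> W"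
      and VW: "\<forall>v\<in>V. \<forall>w\<in>W. v \<squnion> w \<in> carrier L - C"
      by blast
    then obtain z where z: "z \<in> V" "z \<in> W" "z \<in> C" using meets[of V W] x y by blast
    then have "z \<squnion> z \<in> carrier L - C" using VW by blast
    moreover have "z \<squnion> z = z"
      using join_le[of z z z] join_left[of z z] z(3) Cc le_antisym le_refl join_closed subsetD[OF Cc z(3)]
      by simp
    ultimately show False using z by simp
  qed
  have "directed_in L C"
    unfolding directed_in_def
  proof (intro conjI ballI Cc ne)
    fix x y assume xy: "x \<in> C" "y \<in> C"
    then have "x \<in> carrier L" "y \<in> carrier L" using Cc by blast+
    then show "\<exists>z\<in>C. x \<sqsubseteq> z \<and> y \<sqsubseteq> z"
      by (intro bexI[OF _ join_C[OF xy]] conjI join_left join_right)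
  qed
  moreover have "is_lub L (\<Squnion>C) C" using Cc by (rule is_lub_Sup)
  \<comment> \<open>Otherwise the supremum of the directed set \<open>C\<close> would lie in the
    open complement, which would then contain a member of \<open>C\<close>.\<close>
  ultimately have s: "\<Squnion>C \<in> C"
    using scott_open_meets[OF open_C, of C "\<Squnion>C"] sup_closed[OF Cc] by blast
  have "?T closure_of {\<Squnion>C} = C"
  proof -
    have "y \<in> C" if "y \<in> carrier L" "y \<sqsubseteq> \<Squnion>C" for y
      using scott_open_upper[OF open_C, of y "\<Squnion>C"] that s Cc by blast
    then show ?thesis
      using Cc s sup_upper[OF Cc] by (auto simp: scott_closure_of_singleton)
  qed
  moreover have "x = y" if "x \<in> carrier L" "y \<in> carrier L"
    "?T closure_of {x} = C" "?T closure_of {y} = C" for x y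
  proof (rule le_antisym)
    have "{z \<in> carrier L. z \<sqsubseteq> x} = {z \<in> carrier L. z \<sqsubseteq> y}"
      using that by (simp add: scott_closure_of_singleton)
    then show "x \<sqsubseteq> y" "y \<sqsubseteq> x" using that(1,2) le_refl by blast+
  qed (use that in simp_all)
  ultimately show "\<exists>!x. x \<in> topspace ?T \<and> ?T closure_of {x} = C"
    using sup_closed[OF Cc] by auto
qed

end

section \<open>Tree presentations\<close>

text \<open>Only the paths along \<open>ch\<close> form a tree; nodes may have several parents. The
  third clause says that the values generate \<open>L\<close> under joins. The last one says that
  the filter generated by the values along a branch is completely prime: it suffices to start at
  \<open>b 0\<close>, since every tail of a branch is a branch.\<close>

definition tree_presentation ::
    "'a gorder \<Rightarrow> 'n set \<Rightarrow> ('n \<Rightarrow> 'n set) \<Rightarrow> ('n \<Rightarrow> 'a) \<Rightarrow> bool" where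
  "tree_presentation L N ch val \<longleftrightarrow>
     val \<in> N \<rightarrow> carrier L \<and>
     (\<forall>s\<in>N. ch s \<subseteq> N \<and> is_lub L (val s) (val ` ch s)) \<and>
     (\<forall>a\<in>carrier L. \<exists>S\<subseteq>N. is_lub L a (val ` S)) \<and>
     (\<forall>b D d. (\<forall>k. b k \<in> N \<and> b (Suc k) \<in> ch (b k)) \<and> D \<subseteq> carrier L \<and> is_lub L d D \<and>
        val (b 0) \<sqsubseteq>\<^bsub>L\<^esub> d \<longrightarrow> (\<exists>k. \<exists>x\<in>D. val (b k) \<sqsubseteq>\<^bsub>L\<^esub> x))"

lemma tree_presentationD:
  assumes "tree_presentation L N ch val"
  shows "s \<in> N \<Longrightarrow> val s \<in> carrier L"
    and "s \<in> N \<Longrightarrow> ch s \<subseteq> N"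
    and "s \<in> N \<Longrightarrow> is_lub L (val s) (val ` ch s)"
    and "a \<in> carrier L \<Longrightarrow> \<exists>S\<subseteq>N. is_lub L a (val ` S)"
    and "\<lbrakk>\<And>k. b k \<in> N; \<And>k. b (Suc k) \<in> ch (b k); D \<subseteq> carrier L; is_lub L d D;
          val (b 0) \<sqsubseteq>\<^bsub>L\<^esub> d\<rbrakk> \<Longrightarrow> \<exists>k. \<exists>x\<in>D. val (b k) \<sqsubseteq>\<^bsub>L\<^esub> x"
  using assms unfolding tree_presentation_def by blast+

lemma tree_presentation_child_le:
  assumes "tree_presentation L N ch val" "s \<in> N" "t \<in> ch s"
  shows "val t \<sqsubseteq>\<^bsub>L\<^esub> val s"
proof -
  have "val ` ch s \<subseteq> carrier L"
    using tree_presentationD(1,2)[OF assms(1)] assms(2) by blast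
  then show ?thesis
    using tree_presentationD(3)[OF assms(1,2)] assms(3) least_Upper_above by fast
qed

context plain_complete_lattice
begin

text \<open>
  The branches through the levels \<open>F k\<close> are the points of a compact set, and the set below consists
  of the opens that contain it; Koenig's lemma is what makes it compact.
\<close>

lemma scott_open_levels:
  assumes pres: "tree_presentation L N ch val"
    and F: "\<And>k. finite (F k)" "\<And>k. F k \<subseteq> N" "\<And>k. F (Suc k) \<subseteq> \<Union>(ch ` F k)"
  shows "scott_open L {x \<in> carrier L. \<exists>k. \<forall>s\<in>F k. val s \<sqsubseteq> x}"
  unfolding scott_open_def
proof (intro conjI ballI allI impI)
  note pD = tree_presentationD[OF pres]
  fix x y assume x: "x \<in> {x \<in> carrier L. \<exists>k. \<forall>s\<in>F k. val s \<sqsubseteq> x}"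
    and y: "y \<in> carrier L" "x \<sqsubseteq> y"
  then obtain k where k: "x \<in> carrier L" "\<forall>s\<in>F k. val s \<sqsubseteq> x" by blast
  have "val s \<sqsubseteq> y" if s: "s \<in> F k" for s
    by (rule le_trans[OF _ y(2) pD(1) k(1) y(1)]) (use k s F(2) in blast)+
  then show "y \<in> {x \<in> carrier L. \<exists>k. \<forall>s\<in>F k. val s \<sqsubseteq> x}" using y(1) by blast
next
  note pD = tree_presentationD[OF pres]
  fix D d assume D': "directed_in L D \<and> is_lub L d D \<and> d \<in> {x \<in> carrier L. \<exists>k. \<forall>s\<in>F k. val s \<sqsubseteq> x}"
  then have D: "directed_in L D" "is_lub L d D" "D \<subseteq> carrier L" "D \<noteq> {}"
    by (auto simp: directed_in_def)
  obtain k where k: "\<forall>s\<in>F k. val s \<sqsubseteq> d" using D' by blast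
  have finite_bound: "\<exists>x\<in>D. \<forall>s\<in>A. val s \<sqsubseteq> x"
    if "finite A" "A \<subseteq> N" "\<forall>s\<in>A. \<exists>x\<in>D. val s \<sqsubseteq> x" for A
    using that
  proof (induction A)
    case empty
    then show ?case using D(4) by blast
  next
    case (insert s A)
    then obtain x y where x: "x \<in> D" "\<forall>t\<in>A. val t \<sqsubseteq> x" and y: "y \<in> D" "val s \<sqsubseteq> y" by auto
    then obtain z where z: "z \<in> D" "x \<sqsubseteq> z" "y \<sqsubseteq> z" using D(1) unfolding directed_in_def by blast
    have c: "x \<in> carrier L" "y \<in> carrier L" "z \<in> carrier L" using x y z D(3) by blast+
    have "val t \<sqsubseteq> z" if t: "t \<in> insert s A" for t
    proof -
      have "val t \<in> carrier L" using t insert.prems pD(1) by blast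
      moreover have "val t \<sqsubseteq> x \<or> val t \<sqsubseteq> y" using t x y by blast
      ultimately show ?thesis using z c le_trans by blast
    qed
    then show ?case using z(1) by blast
  qed
  have "\<exists>j. \<forall>s\<in>F j. \<exists>x\<in>D. val s \<sqsubseteq> x"
  proof (rule ccontr)
    assume none: "\<not> ?thesis"
    \<comment> \<open>The nodes at level \<open>k + j\<close> that lie below no member of
      \<open>D\<close>. Since values decrease from parent to child, a parent of such a node is of
      the same kind. An infinite branch through them starts below \<open>d\<close> and contradicts
      the last clause of \<open>tree_presentation\<close>.\<close>
    define B where "B j = {s \<in> F (k + j). \<not> (\<exists>x\<in>D. val s \<sqsubseteq> x)}" for j
    have pred: "\<exists>s\<in>B j. t \<in> ch s" if t: "t \<in> B (Suc j)" for j t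
    proof -
      obtain s where s: "s \<in> F (k + j)" "t \<in> ch s" using t F(3)[of "k + j"] by (auto simp: B_def)
      have sN: "s \<in> N" using s F(2) by blast
      have tN: "t \<in> N" using s(2) pD(2)[OF sN] by blast
      have "\<not> val s \<sqsubseteq> x" if x: "x \<in> D" for x
      proof
        assume "val s \<sqsubseteq> x"
        then have "val t \<sqsubseteq> x"
          by (rule le_trans[OF tree_presentation_child_le[OF pres sN s(2)] _ pD(1)[OF tN] pD(1)[OF sN]
                subsetD[OF D(3) x]])
        then show False using t x by (auto simp: B_def)
      qed
      then show ?thesis using s by (auto simp: B_def)
    qed
    obtain b where b: "\<And>j. b j \<in> B j" "\<And>j. b (Suc j) \<in> ch (b j)"
    proof (rule koenig[where B = B and E = "\<lambda>s t. t \<in> ch s"])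
      show "finite (B j)" for j unfolding B_def using F(1) by simp
      show "B j \<noteq> {}" for j unfolding B_def using none by blast
    qed (use pred in blast)+
    have "b j \<in> N" for j using b(1)[of j] F(2) by (auto simp: B_def)
    moreover have "val (b 0) \<sqsubseteq> d" using b(1)[of 0] k by (auto simp: B_def)
    ultimately have "\<exists>j. \<exists>x\<in>D. val (b j) \<sqsubseteq> x" using pD(5)[of b, OF _ b(2) D(3) D(2)] by blast
    then show False using b(1) by (auto simp: B_def)
  qed
  then obtain j x where "x \<in> D" "\<forall>s\<in>F j. val s \<sqsubseteq> x"
    using finite_bound[OF F(1) F(2)] by blast
  then show "D \<inter> {x \<in> carrier L. \<exists>k. \<forall>s\<in>F k. val s \<sqsubseteq> x} \<noteq> {}" using D(3) by blast
qed blast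

text \<open>Replacing nodes by all their children preserves the join, and openness of
  \<open>U\<close> allows thinning to finite sets afterwards. Both sides are thinned together, so
  that the joint join stays in \<open>U\<close> at every level.\<close>

lemma join_continuous_if_tree_presentation:
  assumes pres: "tree_presentation L N ch val"
    and U: "scott_open L U" and x: "x \<in> carrier L" and y: "y \<in> carrier L" and xy: "x \<squnion> y \<in> U"
  shows "\<exists>V W. scott_open L V \<and> scott_open L W \<and> x \<in> V \<and> y \<in> W \<and> (\<forall>v\<in>V. \<forall>w\<in>W. v \<squnion> w \<in> U)"
proof -
  note pD = tree_presentationD[OF pres]
  define good where "good = (\<lambda>(F, G). finite F \<and> finite G \<and> F \<subseteq> N \<and> G \<subseteq> N \<and> \<Squnion>(val ` (F \<union> G)) \<in> U)"
  \<comment> \<open>One finite set \<open>H\<close> is extracted from the union and then split into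
    \<open>H \<inter> A\<close> and \<open>H \<inter> B\<close>; either part may be empty.\<close>
  have shrink: "\<exists>F G. good (F, G) \<and> F \<subseteq> A \<and> G \<subseteq> B"
    if A: "A \<subseteq> N" and B: "B \<subseteq> N" and AB: "\<Squnion>(val ` (A \<union> B)) \<in> U" for A B
  proof -
    have "val ` (A \<union> B) \<subseteq> carrier L" using A B pD(1) by blast
    then obtain T where T: "finite T" "T \<subseteq> val ` (A \<union> B)" "\<Squnion>T \<in> U"
      using scott_open_finite_Sup[OF U _ AB] by blast
    then obtain H where "finite H" "H \<subseteq> A \<union> B" "T = val ` H" by (meson finite_subset_image)
    then have "good (H \<inter> A, H \<inter> B)"
      using T(3) A B by (auto simp: good_def Int_Un_distrib[symmetric] Int_absorb2)
    then show ?thesis by blast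
  qed
  obtain S where S: "S \<subseteq> N" "is_lub L x (val ` S)" using pD(4)[OF x] by blast
  obtain S' where S': "S' \<subseteq> N" "is_lub L y (val ` S')" using pD(4)[OF y] by blast
  have val_in: "val ` A \<subseteq> carrier L" if "A \<subseteq> N" for A using that pD(1) by blast
  have SS: "val ` S \<subseteq> carrier L" "val ` S' \<subseteq> carrier L" "val ` (S \<union> S') \<subseteq> carrier L"
    using S(1) S'(1) by (simp_all only: val_in Un_subset_iff)
  have "x \<squnion> y \<sqsubseteq> \<Squnion>(val ` (S \<union> S'))"
  proof (rule join_le[OF _ _ x y])
    show "x \<sqsubseteq> \<Squnion>(val ` (S \<union> S'))"
      using S(2) sup_closed[OF SS(3)] sup_upper[OF SS(3)] unfolding is_lub_iff[OF SS(1)] by blast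
    show "y \<sqsubseteq> \<Squnion>(val ` (S \<union> S'))"
      using S'(2) sup_closed[OF SS(3)] sup_upper[OF SS(3)] unfolding is_lub_iff[OF SS(2)] by blast
  qed (use SS in simp)
  then have "\<Squnion>(val ` (S \<union> S')) \<in> U" using scott_open_upper[OF U xy] SS by simp
  then have start: "\<exists>P. good P \<and> fst P \<subseteq> S \<and> snd P \<subseteq> S'"
    using shrink[OF S(1) S'(1)] by fastforce
  have step: "\<exists>Q. good Q \<and> fst Q \<subseteq> \<Union>(ch ` fst P) \<and> snd Q \<subseteq> \<Union>(ch ` snd P)" if P: "good P" for P
  proof -
    obtain F G where P': "P = (F, G)" by fastforce
    have FG: "F \<subseteq> N" "G \<subseteq> N" "\<Squnion>(val ` (F \<union> G)) \<in> U" using P by (auto simp: good_def P')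
    have ch: "\<Union>(ch ` F) \<subseteq> N" "\<Union>(ch ` G) \<subseteq> N" using FG pD(2) by blast+
    let ?H = "val ` (\<Union>(ch ` F) \<union> \<Union>(ch ` G))"
    have c: "val ` (F \<union> G) \<subseteq> carrier L" "?H \<subseteq> carrier L"
      using FG(1,2) ch by (simp_all only: val_in Un_subset_iff)
    have "\<Squnion>(val ` (F \<union> G)) \<sqsubseteq> \<Squnion>?H"
    proof (rule sup_least[OF c(1) sup_closed[OF c(2)]])
      fix a assume "a \<in> val ` (F \<union> G)"
      then obtain s where s: "s \<in> F \<union> G" "a = val s" by blast
      then have sN: "s \<in> N" using FG by blast
      have H: "val ` ch s \<subseteq> ?H" using s by blast
      then have "val ` ch s \<subseteq> carrier L" using c(2) by (rule subset_trans)
      moreover have "\<forall>a\<in>val ` ch s. a \<sqsubseteq> \<Squnion>?H"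
        using H sup_upper[OF c(2)] by blast
      ultimately show "a \<sqsubseteq> \<Squnion>?H"
        using pD(3)[OF sN] sup_closed[OF c(2)] s(2) by (simp add: is_lub_iff)
    qed
    then have "\<Squnion>?H \<in> U" using scott_open_upper[OF U FG(3)] c by simp
    then show ?thesis using shrink[OF ch] by (auto simp: P')
  qed
  \<comment> \<open>The clause for \<open>n = 0\<close> carries the initial inclusions through
    dependent choice; they place the first levels below \<open>x\<close> and
    \<open>y\<close>.\<close>
  have "\<exists>f. \<forall>n. (good (f n) \<and> (n = 0 \<longrightarrow> fst (f n) \<subseteq> S \<and> snd (f n) \<subseteq> S')) \<and>
      fst (f (Suc n)) \<subseteq> \<Union>(ch ` fst (f n)) \<and> snd (f (Suc n)) \<subseteq> \<Union>(ch ` snd (f n))"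
    by (rule dependent_nat_choice) (use start step in auto)
  then obtain PQ where PQ: "\<forall>n. (good (PQ n) \<and> (n = 0 \<longrightarrow> fst (PQ n) \<subseteq> S \<and> snd (PQ n) \<subseteq> S')) \<and>
      fst (PQ (Suc n)) \<subseteq> \<Union>(ch ` fst (PQ n)) \<and> snd (PQ (Suc n)) \<subseteq> \<Union>(ch ` snd (PQ n))" ..
  define F where "F n = fst (PQ n)" for n
  define G where "G n = snd (PQ n)" for n
  have gd: "finite (F n)" "finite (G n)" "F n \<subseteq> N" "G n \<subseteq> N" "\<Squnion>(val ` (F n \<union> G n)) \<in> U" for n
    using PQ[rule_format, of n] by (simp_all add: F_def G_def good_def case_prod_beta)
  have F: "finite (F n)" "F n \<subseteq> N" "F (Suc n) \<subseteq> \<Union>(ch ` F n)" for n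
    using PQ[rule_format, of n] gd by (simp_all add: F_def)
  have G: "finite (G n)" "G n \<subseteq> N" "G (Suc n) \<subseteq> \<Union>(ch ` G n)" for n
    using PQ[rule_format, of n] gd by (simp_all add: G_def)
  have FG0: "F 0 \<subseteq> S" "G 0 \<subseteq> S'" using PQ[rule_format, of 0] by (simp_all add: F_def G_def)
  \<comment> \<open>An element above one level is above all later ones. This allows the indices
    \<open>k\<close> and \<open>l\<close> witnessing membership in the two open sets to be replaced
    by \<open>k + l\<close>.\<close>
  have below: "\<forall>s\<in>H (k + j). val s \<sqsubseteq> z"
    if H: "\<And>n. H n \<subseteq> N" "\<And>n. H (Suc n) \<subseteq> \<Union>(ch ` H n)" and z: "z \<in> carrier L" "\<forall>s\<in>H k. val s \<sqsubseteq> z"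
    for H k j z
  proof (induction j)
    case (Suc j)
    show ?case
    proof
      fix t assume "t \<in> H (k + Suc j)"
      then obtain s where s: "s \<in> H (k + j)" "t \<in> ch s" using H(2)[of "k + j"] by auto
      have sN: "s \<in> N" using s H(1) by blast
      have tN: "t \<in> N" using s pD(2)[OF sN] by blast
      have "val s \<sqsubseteq> z" using Suc s(1) by blast
      then show "val t \<sqsubseteq> z"
        by (rule le_trans[OF tree_presentation_child_le[OF pres sN s(2)] _
              pD(1)[OF tN] pD(1)[OF sN] z(1)])
    qed
  qed (use z in simp)
  let ?V = "{x \<in> carrier L. \<exists>k. \<forall>s\<in>F k. val s \<sqsubseteq> x}" and ?W = "{x \<in> carrier L. \<exists>k. \<forall>s\<in>G k. val s \<sqsubseteq> x}"
  have "x \<in> ?V"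
    using S(2) FG0(1) x unfolding is_lub_iff[OF SS(1)] by blast
  moreover have "y \<in> ?W"
    using S'(2) FG0(2) y unfolding is_lub_iff[OF SS(2)] by blast
  moreover have "v \<squnion> w \<in> U" if v: "v \<in> ?V" and w: "w \<in> ?W" for v w
  proof -
    obtain k l where k: "\<forall>s\<in>F k. val s \<sqsubseteq> v" and l: "\<forall>s\<in>G l. val s \<sqsubseteq> w" using v w by blast
    have vw: "v \<in> carrier L" "w \<in> carrier L" using v w by simp_all
    have kl: "\<forall>s\<in>F (k + l). val s \<sqsubseteq> v" "\<forall>s\<in>G (k + l). val s \<sqsubseteq> w"
      using below[of F, OF F(2,3) vw(1) k, of l] below[of G, OF G(2,3) vw(2) l, of k]
      by (simp_all add: add.commute)
    have c: "val ` (F (k + l) \<union> G (k + l)) \<subseteq> carrier L"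
      using F(2) G(2) by (simp only: val_in Un_subset_iff)
    have "\<Squnion>(val ` (F (k + l) \<union> G (k + l))) \<sqsubseteq> v \<squnion> w"
    proof (rule sup_least[OF c join_closed[OF vw]])
      fix a assume a: "a \<in> val ` (F (k + l) \<union> G (k + l))"
      then have ac: "a \<in> carrier L" using c by (rule subsetD[rotated])
      have "a \<sqsubseteq> v \<or> a \<sqsubseteq> w" using a kl by blast
      then show "a \<sqsubseteq> v \<squnion> w"
        using le_trans[OF _ join_left[OF vw] ac vw(1) join_closed[OF vw]]
          le_trans[OF _ join_right[OF vw] ac vw(2) join_closed[OF vw]] by (elim disjE)
    qed
    then show ?thesis using scott_open_upper[OF U gd(5)] v w by simp
  qed
  ultimately show ?thesis
    by (intro exI[of _ ?V] exI[of _ ?W] conjI ballI scott_open_levels[where F = F, OF pres F]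
        scott_open_levels[where F = G, OF pres G])
qed

end

section \<open>Products and isomorphic copies\<close>

text \<open>The order is definable from the meet, which \<open>f\<close> preserves; injectivity of
  \<open>f\<close> gives the converse implication.\<close>

lemma frame_isomorphicE:
  assumes "frame L" "frame M" "frame_isomorphic L M"
  obtains f where "bij_betw f (carrier L) (carrier M)"
    "\<And>x y. x \<in> carrier L \<Longrightarrow> y \<in> carrier L \<Longrightarrow> x \<sqsubseteq>\<^bsub>L\<^esub> y \<longleftrightarrow> f x \<sqsubseteq>\<^bsub>M\<^esub> f y"
proof -
  interpret L: frame L by fact
  interpret M: frame M by fact
  obtain f where hom: "frame_hom L M f" and bij: "bij_betw f (carrier L) (carrier M)"
    using assms(3) unfolding frame_isomorphic_def by blast
  have "x \<sqsubseteq>\<^bsub>L\<^esub> y \<longleftrightarrow> f x \<sqsubseteq>\<^bsub>M\<^esub> f y" if xy: "x \<in> carrier L" "y \<in> carrier L" for x y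
  proof -
    have fxy: "f x \<in> carrier M" "f y \<in> carrier M" using bij xy bij_betwE by blast+
    have "x \<sqsubseteq>\<^bsub>L\<^esub> y \<longleftrightarrow> x \<sqinter>\<^bsub>L\<^esub> y = x" using L.le_iff_join[OF xy] by auto
    also have "\<dots> \<longleftrightarrow> f (x \<sqinter>\<^bsub>L\<^esub> y) = f x"
      using inj_on_eq_iff[OF bij_betw_imp_inj_on[OF bij] L.meet_closed[OF xy] xy(1)] by simp
    also have "\<dots> \<longleftrightarrow> f x \<sqinter>\<^bsub>M\<^esub> f y = f x"
      using hom xy by (simp add: frame_hom_def)
    also have "\<dots> \<longleftrightarrow> f x \<sqsubseteq>\<^bsub>M\<^esub> f y" using M.le_iff_join[OF fxy] by auto
    finally show ?thesis .
  qed
  then show thesis using that bij by blast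
qed

text \<open>Nodes and children stay, and only the values move along the inverse of \<open>f\<close>.
  All clauses speak of order and suprema, which an order isomorphism preserves and reflects.\<close>

lemma tree_presentation_order_iso:
  assumes pres: "tree_presentation M N ch val"
    and bij: "bij_betw f (carrier L) (carrier M)"
    and le: "\<And>x y. x \<in> carrier L \<Longrightarrow> y \<in> carrier L \<Longrightarrow> x \<sqsubseteq>\<^bsub>L\<^esub> y \<longleftrightarrow> f x \<sqsubseteq>\<^bsub>M\<^esub> f y"
  shows "tree_presentation L N ch (\<lambda>s. inv_into (carrier L) f (val s))"
proof -
  note pD = tree_presentationD[OF pres]
  define g where "g = inv_into (carrier L) f"
  have g: "g y \<in> carrier L" "f (g y) = y" if "y \<in> carrier M" for y
    using that bij bij_betw_inv_into_right[OF bij] bij_betwE[OF bij_betw_inv_into[OF bij]]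
    by (auto simp: g_def)
  have f: "f x \<in> carrier M" if "x \<in> carrier L" for x using that bij bij_betwE by blast
  have fA: "f ` A \<subseteq> carrier M" if "A \<subseteq> carrier L" for A using that f by blast
  have lub: "is_lub L x A \<longleftrightarrow> is_lub M (f x) (f ` A)" if x: "x \<in> carrier L" and A: "A \<subseteq> carrier L" for x A
  proof -
    have "(\<forall>u\<in>carrier L. (\<forall>a\<in>A. a \<sqsubseteq>\<^bsub>L\<^esub> u) \<longrightarrow> x \<sqsubseteq>\<^bsub>L\<^esub> u) \<longleftrightarrow>
        (\<forall>u\<in>carrier L. (\<forall>a\<in>A. f a \<sqsubseteq>\<^bsub>M\<^esub> f u) \<longrightarrow> f x \<sqsubseteq>\<^bsub>M\<^esub> f u)"
      using le x A by (meson subsetD)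
    also have "\<dots> \<longleftrightarrow> (\<forall>u\<in>f ` carrier L. (\<forall>a\<in>A. f a \<sqsubseteq>\<^bsub>M\<^esub> u) \<longrightarrow> f x \<sqsubseteq>\<^bsub>M\<^esub> u)" by simp
    also have "f ` carrier L = carrier M" using bij by (simp add: bij_betw_def)
    finally show ?thesis
      unfolding is_lub_iff[OF A] is_lub_iff[OF fA[OF A]] using x f[OF x] le A by (auto simp: subset_iff)
  qed
  have fg: "f ` (\<lambda>s. g (val s)) ` S = val ` S" if "S \<subseteq> N" for S
    unfolding image_image by (rule image_cong[OF refl]) (use that g(2) pD(1) in blast)
  have gval: "(\<lambda>s. g (val s)) ` S \<subseteq> carrier L" if "S \<subseteq> N" for S
    using that g(1) pD(1) by blast
  show ?thesis
    unfolding tree_presentation_def g_def[symmetric]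
  proof (intro conjI allI ballI impI)
    show "(\<lambda>s. g (val s)) \<in> N \<rightarrow> carrier L" using g(1) pD(1) by blast
  next
    fix s assume s: "s \<in> N"
    then show ch: "ch s \<subseteq> N" by (rule pD(2))
    show "is_lub L (g (val s)) ((\<lambda>s. g (val s)) ` ch s)"
      using pD(3)[OF s] g[OF pD(1)[OF s]] by (simp add: lub[OF _ gval[OF ch]] fg[OF ch])
  next
    fix a assume a: "a \<in> carrier L"
    obtain S where S: "S \<subseteq> N" "is_lub M (f a) (val ` S)" using pD(4)[OF f[OF a]] by blast
    then have "is_lub L a ((\<lambda>s. g (val s)) ` S)" by (simp add: lub[OF a gval[OF S(1)]] fg[OF S(1)])
    then show "\<exists>S\<subseteq>N. is_lub L a ((\<lambda>s. g (val s)) ` S)" using S(1) by blast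
  next
    fix b D d
    assume *: "(\<forall>k. b k \<in> N \<and> b (Suc k) \<in> ch (b k)) \<and> D \<subseteq> carrier L \<and> is_lub L d D \<and> g (val (b 0)) \<sqsubseteq>\<^bsub>L\<^esub> d"
    then have bN: "b k \<in> N" and D: "D \<subseteq> carrier L" and d: "d \<in> carrier L" for k by auto
    have gb: "g (val (b k)) \<sqsubseteq>\<^bsub>L\<^esub> x \<longleftrightarrow> val (b k) \<sqsubseteq>\<^bsub>M\<^esub> f x" if "x \<in> carrier L" for k x
      using le[OF g(1)[OF pD(1)[OF bN]] that] g(2)[OF pD(1)[OF bN]] by simp
    have "\<exists>k. \<exists>x\<in>f ` D. val (b k) \<sqsubseteq>\<^bsub>M\<^esub> x"
    proof (rule pD(5)[where b = b])
      show "is_lub M (f d) (f ` D)" using * lub[OF d D] by blast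
      show "val (b 0) \<sqsubseteq>\<^bsub>M\<^esub> f d" using * gb[OF d] by blast
    qed (use * fA[OF D] in blast)+
    then obtain k x where "x \<in> D" "val (b k) \<sqsubseteq>\<^bsub>M\<^esub> f x" by blast
    then show "\<exists>k. \<exists>x\<in>D. g (val (b k)) \<sqsubseteq>\<^bsub>L\<^esub> x" using gb D by blast
  qed
qed

section \<open>Products of complete lattices and of their trees\<close>

lemma product_order_sel [simp]:
  "carrier (product_order I L) = (\<Pi>\<^sub>E i\<in>I. carrier (L i))"
  "eq (product_order I L) = (=)"
  "x \<sqsubseteq>\<^bsub>product_order I L\<^esub> y \<longleftrightarrow> (\<forall>i\<in>I. x i \<sqsubseteq>\<^bsub>L i\<^esub> y i)"
  by (simp_all add: product_order_def)

lemma is_lub_product_order: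
  assumes D: "D \<subseteq> (\<Pi>\<^sub>E i\<in>I. carrier (L i))" and s: "s \<in> extensional I"
    and lub: "\<And>i. i \<in> I \<Longrightarrow> is_lub (L i) (s i) ((\<lambda>x. x i) ` D)"
  shows "is_lub (product_order I L) s D"
proof -
  have D': "D \<subseteq> carrier (product_order I L)" using D by simp
  have Di: "(\<lambda>x. x i) ` D \<subseteq> carrier (L i)" if "i \<in> I" for i
    using D that by (auto simp: PiE_iff)
  show ?thesis
    unfolding is_lub_iff[OF D']
  proof (intro conjI ballI impI)
    show "s \<in> carrier (product_order I L)" using lub s by (auto simp: PiE_iff)
    show "x \<sqsubseteq>\<^bsub>product_order I L\<^esub> s" if "x \<in> D" for x
      using that lub Di by (auto simp: is_lub_iff)
    fix u assume u: "u \<in> carrier (product_order I L)" "\<forall>a\<in>D. a \<sqsubseteq>\<^bsub>product_order I L\<^esub> u"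
    then show "s \<sqsubseteq>\<^bsub>product_order I L\<^esub> u"
      using lub Di by (auto simp: is_lub_iff PiE_iff)
  qed
qed

lemma partial_order_product_order:
  assumes "\<And>i. i \<in> I \<Longrightarrow> partial_order (L i)"
  shows "partial_order (product_order I L)"
proof unfold_locales
  let ?P = "product_order I L"
  fix x y assume xy: "x \<in> carrier ?P" "y \<in> carrier ?P"
  show "x \<sqsubseteq>\<^bsub>?P\<^esub> x"
    using xy assms partial_order.axioms(1) weak_partial_order.le_refl by (fastforce simp: PiE_iff)
  show "x .=\<^bsub>?P\<^esub> y" if "x \<sqsubseteq>\<^bsub>?P\<^esub> y" "y \<sqsubseteq>\<^bsub>?P\<^esub> x"
    using xy that assms partial_order.le_antisym by (fastforce simp: PiE_iff intro!: extensionalityI)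
  fix z assume z: "z \<in> carrier ?P" and le: "x \<sqsubseteq>\<^bsub>?P\<^esub> y" "y \<sqsubseteq>\<^bsub>?P\<^esub> z"
  have "x i \<sqsubseteq>\<^bsub>L i\<^esub> z i" if i: "i \<in> I" for i
  proof -
    interpret partial_order "L i" using assms i by blast
    show ?thesis using le xy z i le_trans[of "x i" "y i" "z i"] by (simp add: PiE_iff)
  qed
  then show "x \<sqsubseteq>\<^bsub>?P\<^esub> z" by simp
qed simp_all

lemma complete_lattice_product_order:
  assumes "\<And>i. i \<in> I \<Longrightarrow> complete_lattice (L i)"
  shows "complete_lattice (product_order I L)"
proof (rule complete_latticeI_Sup)
  show "partial_order (product_order I L)"
    by (rule partial_order_product_order) (use assms complete_lattice.axioms(1) in blast)
  fix A assume A: "A \<subseteq> carrier (product_order I L)"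
  have "is_lub (product_order I L) (\<lambda>i\<in>I. \<Squnion>\<^bsub>L i\<^esub>((\<lambda>x. x i) ` A)) A"
  proof (rule is_lub_product_order)
    fix i assume i: "i \<in> I"
    interpret complete_lattice "L i" using assms i .
    show "is_lub (L i) ((\<lambda>i\<in>I. \<Squnion>\<^bsub>L i\<^esub>((\<lambda>x. x i) ` A)) i) ((\<lambda>x. x i) ` A)"
      using is_lub_Sup[of "(\<lambda>x. x i) ` A"] A i by (auto simp: PiE_iff subset_iff)
  qed (use A in simp_all)
  then show "\<exists>s. is_lub (product_order I L) s A" by blast
qed

text \<open>For \<open>i \<in> I\<close> this is the left adjoint of the projection to coordinate
  \<open>i\<close>; \<open>at_coord_le_iff\<close> is the adjunction.\<close>

definition at_coord :: "'i set \<Rightarrow> ('i \<Rightarrow> 'a gorder) \<Rightarrow> 'i \<Rightarrow> 'a \<Rightarrow> 'i \<Rightarrow> 'a" where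
  "at_coord I L i v = (\<lambda>j\<in>I. if j = i then v else \<bottom>\<^bsub>L j\<^esub>)"

lemma at_coord_in_carrier:
  assumes "\<And>i. i \<in> I \<Longrightarrow> complete_lattice (L i)" "v \<in> carrier (L i)"
  shows "at_coord I L i v \<in> carrier (product_order I L)"
proof -
  have "\<bottom>\<^bsub>L j\<^esub> \<in> carrier (L j)" if "j \<in> I" for j
  proof -
    interpret complete_lattice "L j" using assms(1) that .
    show ?thesis by (rule bottom_closed)
  qed
  then show ?thesis using assms(2) by (auto simp: at_coord_def)
qed

lemma at_coord_le_iff:
  assumes "\<And>i. i \<in> I \<Longrightarrow> complete_lattice (L i)" "i \<in> I" "u \<in> carrier (product_order I L)"
  shows "at_coord I L i v \<sqsubseteq>\<^bsub>product_order I L\<^esub> u \<longleftrightarrow> v \<sqsubseteq>\<^bsub>L i\<^esub> u i"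
proof -
  have "\<bottom>\<^bsub>L j\<^esub> \<sqsubseteq>\<^bsub>L j\<^esub> u j" if "j \<in> I" for j
  proof -
    interpret complete_lattice "L j" using assms(1) that .
    show ?thesis using assms(3) that by (intro bottom_lower) (auto simp: PiE_iff)
  qed
  then show ?thesis using assms(2) by (auto simp: at_coord_def)
qed

text \<open>An element of the product is the join of its coordinates embedded by
  \<open>at_coord\<close>. A branch of the disjoint union never leaves its coordinate, and suprema
  are coordinatewise, so the branch condition is inherited from that factor.\<close>

lemma tree_presentation_product_order:
  assumes L: "\<And>i. i \<in> I \<Longrightarrow> complete_lattice (L i)"
    and pres: "\<And>i. i \<in> I \<Longrightarrow> tree_presentation (L i) (N i) (ch i) (val i)"
  shows "tree_presentation (product_order I L) (Sigma I N) (\<lambda>(i, s). Pair i ` ch i s)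
    (\<lambda>(i, s). at_coord I L i (val i s))"
proof -
  let ?P = "product_order I L" and ?val = "\<lambda>(i, s). at_coord I L i (val i s)"
  interpret P: complete_lattice ?P by (rule complete_lattice_product_order[OF L])
  note pD = tree_presentationD[OF pres]
  have val_in: "?val n \<in> carrier ?P" if "n \<in> Sigma I N" for n
    using that pD(1) at_coord_in_carrier[of I L] L by (auto simp del: product_order_sel)
  have val_le: "?val (i, s) \<sqsubseteq>\<^bsub>?P\<^esub> u \<longleftrightarrow> val i s \<sqsubseteq>\<^bsub>L i\<^esub> u i"
    if "i \<in> I" "u \<in> carrier ?P" for i s u
    using at_coord_le_iff[of I L i u "val i s"] L that by simp
  have coord: "u i \<in> carrier (L i)" if "i \<in> I" "u \<in> carrier ?P" for i u
    using that by (auto simp: PiE_iff)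
  show ?thesis
    unfolding tree_presentation_def
  proof (intro conjI allI ballI impI)
    show "?val \<in> Sigma I N \<rightarrow> carrier ?P" using val_in by blast
  next
    fix n assume "n \<in> Sigma I N"
    then obtain i s where n: "n = (i, s)" "i \<in> I" "s \<in> N i" by blast
    have ch: "Pair i ` ch i s \<subseteq> Sigma I N" using pD(2)[OF n(2,3)] n(2) by blast
    then show "(case n of (i, s) \<Rightarrow> Pair i ` ch i s) \<subseteq> Sigma I N" by (simp add: n)
    have c: "?val ` Pair i ` ch i s \<subseteq> carrier ?P" using ch val_in by blast
    have ci: "val i ` ch i s \<subseteq> carrier (L i)" using pD(1,2) n(2,3) by blast
    have lub: "is_lub (L i) (val i s) (val i ` ch i s)" by (rule pD(3)[OF n(2,3)])
    have "is_lub ?P (?val (i, s)) (?val ` Pair i ` ch i s)"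
      unfolding is_lub_iff[OF c]
    proof (intro conjI ballI impI)
      show v: "?val (i, s) \<in> carrier ?P" using val_in n by blast
      fix a assume "a \<in> ?val ` Pair i ` ch i s"
      then obtain t where t: "t \<in> ch i s" "a = ?val (i, t)" by blast
      have "?val (i, s) i = val i s" using n(2) by (simp add: at_coord_def)
      then show "a \<sqsubseteq>\<^bsub>?P\<^esub> ?val (i, s)"
        unfolding t(2) val_le[OF n(2) v] using lub t(1) by (simp add: is_lub_iff[OF ci])
    next
      fix u assume u: "u \<in> carrier ?P" "\<forall>a\<in>?val ` Pair i ` ch i s. a \<sqsubseteq>\<^bsub>?P\<^esub> u"
      then have "\<forall>t\<in>ch i s. val i t \<sqsubseteq>\<^bsub>L i\<^esub> u i" using val_le[OF n(2) u(1)] by blast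
      then show "?val (i, s) \<sqsubseteq>\<^bsub>?P\<^esub> u"
        unfolding val_le[OF n(2) u(1)] using lub coord[OF n(2) u(1)] by (simp add: is_lub_iff[OF ci])
    qed
    then show "is_lub ?P (?val n) (?val ` (case n of (i, s) \<Rightarrow> Pair i ` ch i s))" by (simp add: n)
  next
    fix a assume a: "a \<in> carrier ?P"
    have "\<forall>i\<in>I. \<exists>S. S \<subseteq> N i \<and> is_lub (L i) (a i) (val i ` S)"
      by (rule ballI) (rule pD(4)[OF _ coord[OF _ a]])
    from bchoice[OF this] obtain S where
      S: "\<forall>i\<in>I. S i \<subseteq> N i \<and> is_lub (L i) (a i) (val i ` S i)" ..
    have SN: "Sigma I S \<subseteq> Sigma I N" using S by blast
    then have c: "?val ` Sigma I S \<subseteq> carrier ?P" using val_in by blast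
    have ci: "val i ` S i \<subseteq> carrier (L i)" if "i \<in> I" for i using S that pD(1) by blast
    have "is_lub ?P a (?val ` Sigma I S)"
      unfolding is_lub_iff[OF c]
    proof (intro conjI ballI impI a)
      fix x assume "x \<in> ?val ` Sigma I S"
      then obtain i s where i: "i \<in> I" and s: "s \<in> S i" "x = ?val (i, s)" by blast
      have "is_lub (L i) (a i) (val i ` S i)" using S i by blast
      then show "x \<sqsubseteq>\<^bsub>?P\<^esub> a"
        unfolding s(2) val_le[OF i a] using s(1) by (simp add: is_lub_iff[OF ci[OF i]])
    next
      fix u assume u: "u \<in> carrier ?P" "\<forall>x\<in>?val ` Sigma I S. x \<sqsubseteq>\<^bsub>?P\<^esub> u"
      have "a i \<sqsubseteq>\<^bsub>L i\<^esub> u i" if i: "i \<in> I" for i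
      proof -
        have "\<forall>s\<in>S i. val i s \<sqsubseteq>\<^bsub>L i\<^esub> u i" using u(2) i val_le[OF i u(1)] by blast
        moreover have "is_lub (L i) (a i) (val i ` S i)" using S i by blast
        ultimately show ?thesis using coord[OF i u(1)] by (simp add: is_lub_iff[OF ci[OF i]])
      qed
      then show "a \<sqsubseteq>\<^bsub>?P\<^esub> u" by simp
    qed
    then show "\<exists>S\<subseteq>Sigma I N. is_lub ?P a (?val ` S)" using SN by blast
  next
    fix b D d
    assume *: "(\<forall>k. b k \<in> Sigma I N \<and> b (Suc k) \<in> (case b k of (i, s) \<Rightarrow> Pair i ` ch i s)) \<and>
      D \<subseteq> carrier ?P \<and> is_lub ?P d D \<and> ?val (b 0) \<sqsubseteq>\<^bsub>?P\<^esub> d"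
    then have bN: "b k \<in> Sigma I N" and bch: "b (Suc k) \<in> (case b k of (i, s) \<Rightarrow> Pair i ` ch i s)" for k
      by (simp_all only:)
    from * have D: "D \<subseteq> carrier ?P" and lub: "is_lub ?P d D" and le: "?val (b 0) \<sqsubseteq>\<^bsub>?P\<^esub> d"
      by (simp_all only:)
    define i where "i = fst (b 0)"
    define c where "c k = snd (b k)" for k
    have bk: "b k = (i, c k)" for k
    proof (induction k)
      case (Suc k)
      then show ?case using bch[of k] by (auto simp: c_def)
    qed (simp add: i_def c_def)
    have i: "i \<in> I" and cN: "c k \<in> N i" and cch: "c (Suc k) \<in> ch i (c k)" for k
      using bN[of k] bch[of k] by (auto simp: bk)
    \<comment> \<open>The coordinatewise supremum. It equals \<open>d\<close> by uniqueness, so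
      \<open>d i\<close> is the supremum of the projection of \<open>D\<close>.\<close>
    define e where "e = (\<lambda>j\<in>I. \<Squnion>\<^bsub>L j\<^esub>((\<lambda>x. x j) ` D))"
    have e: "is_lub (L j) (e j) ((\<lambda>x. x j) ` D)" if j: "j \<in> I" for j
    proof -
      interpret complete_lattice "L j" using L j .
      have "(\<lambda>x. x j) ` D \<subseteq> carrier (L j)" using D coord[OF j] by blast
      then show ?thesis using is_lub_Sup j by (simp add: e_def)
    qed
    have "is_lub ?P e D" using D e by (intro is_lub_product_order) (auto simp: e_def)
    then have "d = e" using lub P.least_unique by blast
    have "d \<in> carrier ?P" using lub by blast
    have "\<exists>k. \<exists>x\<in>(\<lambda>x. x i) ` D. val i (c k) \<sqsubseteq>\<^bsub>L i\<^esub> x"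
    proof (rule pD(5)[OF i, where b = c])
      show "is_lub (L i) (d i) ((\<lambda>x. x i) ` D)" using e[OF i] \<open>d = e\<close> by simp
      show "val i (c 0) \<sqsubseteq>\<^bsub>L i\<^esub> d i" using le val_le[OF i \<open>d \<in> carrier ?P\<close>] by (simp add: bk)
      show "(\<lambda>x. x i) ` D \<subseteq> carrier (L i)" using D coord[OF i] by blast
    qed (rule cN, rule cch)
    then obtain k x where kx: "x \<in> D" "val i (c k) \<sqsubseteq>\<^bsub>L i\<^esub> x i" by blast
    then have "?val (b k) \<sqsubseteq>\<^bsub>?P\<^esub> x"
      unfolding bk using val_le[OF i, of x "c k"] D by blast
    then show "\<exists>k. \<exists>x\<in>D. ?val (b k) \<sqsubseteq>\<^bsub>?P\<^esub> x" using kx(1) by blast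
  qed
qed

section \<open>Countably presented frames\<close>

text \<open>
  \<open>p\<close> plays the role of a point of the free frame, and \<open>hits p\<close> is the corresponding
  frame homomorphism to the two-element frame.
\<close>

definition hits :: "'g set \<Rightarrow> 'g set set \<Rightarrow> bool" where
  "hits p U \<longleftrightarrow> (\<exists>F\<in>U. F \<subseteq> p)"

lemma free_frame_memD:
  assumes "U \<in> carrier (free_frame X)" "F \<in> U"
  shows "finite F" "F \<subseteq> X" "\<lbrakk>finite G; F \<subseteq> G; G \<subseteq> X\<rbrakk> \<Longrightarrow> G \<in> U"
  using assms unfolding in_carrier_free_frame_iff by metis+

text \<open>Witnesses \<open>F\<close> and \<open>G\<close> combine to \<open>F \<union> G\<close>,
  which is in both families by upward closure.\<close>

lemma hits_Int:
  assumes U: "U \<in> carrier (free_frame X)" and V: "V \<in> carrier (free_frame X)"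
  shows "hits p (U \<inter> V) \<longleftrightarrow> hits p U \<and> hits p V"
proof
  assume "hits p U \<and> hits p V"
  then obtain F G where F: "F \<in> U" "F \<subseteq> p" and G: "G \<in> V" "G \<subseteq> p" unfolding hits_def by blast
  note FX = free_frame_memD[OF U F(1)] and GX = free_frame_memD[OF V G(1)]
  have "F \<union> G \<in> U" "F \<union> G \<in> V" using FX GX by simp_all
  then show "hits p (U \<inter> V)" using F G unfolding hits_def by blast
qed (auto simp: hits_def)

text \<open>The kernel of \<open>hits p\<close>, which preserves binary meets by
  \<open>hits_Int\<close> and turns unions into disjunctions. It contains the generated congruence
  once \<open>p\<close> respects the relations.\<close>

lemma frame_congruence_hits:
  "frame_congruence (free_frame X)
    {(U, V). U \<in> carrier (free_frame X) \<and> V \<in> carrier (free_frame X) \<and> (hits p U \<longleftrightarrow> hits p V)}"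
  (is "frame_congruence ?F ?\<theta>")
  unfolding frame_congruence_def
proof (intro conjI allI impI)
  show "equiv (carrier ?F) ?\<theta>"
    by (rule equivI) (auto simp: refl_on_def sym_def trans_def)
  fix a b c d assume "(a, b) \<in> ?\<theta> \<and> (c, d) \<in> ?\<theta>"
  then show "(a \<sqinter>\<^bsub>?F\<^esub> c, b \<sqinter>\<^bsub>?F\<^esub> d) \<in> ?\<theta>"
    by (simp add: meet_free_frame hits_Int[where X = X] Int_in_carrier_free_frame)
next
  fix S assume S: "S \<subseteq> ?\<theta>"
  then have c: "fst ` S \<subseteq> carrier ?F" "snd ` S \<subseteq> carrier ?F" by auto
  have "hits p (fst x) \<longleftrightarrow> hits p (snd x)" if "x \<in> S" for x using S that by auto
  moreover have "hits p (\<Union>\<A>) \<longleftrightarrow> (\<exists>U\<in>\<A>. hits p U)" for \<A> by (auto simp: hits_def)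
  ultimately have "hits p (\<Union>(fst ` S)) \<longleftrightarrow> hits p (\<Union>(snd ` S))" by auto
  then show "(\<Squnion>\<^bsub>?F\<^esub>(fst ` S), \<Squnion>\<^bsub>?F\<^esub>(snd ` S)) \<in> ?\<theta>"
    using c by (simp add: Sup_free_frame Union_in_carrier_free_frame)
qed

text \<open>
  The pair \<open>(F, Q)\<close> stands for the inequality between the meet of the generators in \<open>F\<close> and
  the join over \<open>Q\<close>; the pair \<open>({}, {{}})\<close> makes the set of constraints nonempty.
\<close>

definition constraints :: "('g set set \<times> 'g set set) set \<Rightarrow> ('g set \<times> 'g set set) set" where
  "constraints R = insert ({}, {{}}) (\<Union>(P, Q)\<in>R. P \<times> {Q} \<union> Q \<times> {P})"

text \<open>Members of the free frame consist of finite sets over a countable type, so each relation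
  contributes only countably many constraints.\<close>

lemma countable_constraints:
  assumes "countable (R :: ('g::countable set set \<times> 'g set set) set)"
    "R \<subseteq> carrier (free_frame X) \<times> carrier (free_frame X)"
  shows "countable (constraints R)"
proof -
  have "countable U" if "U \<in> carrier (free_frame X)" for U :: "'g set set"
  proof (rule countable_subset[OF _ countable_Collect_finite])
    show "U \<subseteq> Collect finite" using free_frame_memD(1)[OF that] by blast
  qed
  then show ?thesis
    unfolding constraints_def using assms by (auto intro!: countable_UN countable_SIGMA)
qed

text \<open>For finite \<open>A \<subseteq> X\<close> this is the meet of the generators in
  \<open>A\<close>, a basic element of the free frame.\<close>

definition up_gen :: "'g set \<Rightarrow> 'g set \<Rightarrow> 'g set set" where
  "up_gen X A = {G. finite G \<and> A \<subseteq> G \<and> G \<subseteq> X}"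

lemma up_gen_in_carrier: "up_gen X A \<in> carrier (free_frame X)"
  by (auto simp: in_carrier_free_frame_iff up_gen_def)

text \<open>
  A node \<open>(A, k)\<close> says that the generators in \<open>A\<close> are known to belong to the point under
  construction. At level \<open>k\<close> the constraint with index \<open>fst (prod_decode k)\<close> is served, so that
  each constraint is served infinitely often.
\<close>

definition pres_children ::
    "(nat \<Rightarrow> 'g set \<times> 'g set set) \<Rightarrow> 'g set \<times> nat \<Rightarrow> ('g set \<times> nat) set" where
  "pres_children con = (\<lambda>(A, k). let (F, Q) = con (fst (prod_decode k)) in
     if F \<subseteq> A then (\<lambda>G. (A \<union> G, Suc k)) ` Q else {(A, Suc k)})"

text \<open>The union \<open>p\<close> of the finite sets along a branch satisfies every constraint,
  so \<open>hits p\<close> respects \<theta>. A join above the first value is therefore hit by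
  \<open>p\<close> in one of its members, and a finite part of \<open>p\<close> already suffices for
  that.\<close>

lemma tree_presentation_presented_frame:
  fixes X :: "'g set"
  assumes R: "R \<subseteq> carrier (free_frame X) \<times> carrier (free_frame X)"
    and con: "range con = constraints R"
  defines "\<theta> \<equiv> generated_congruence (free_frame X) R"
  shows "tree_presentation (presented_frame X R) ({A. finite A \<and> A \<subseteq> X} \<times> UNIV)
    (pres_children con) (\<lambda>(A, k). \<theta> `` {up_gen X A})"
proof -
  let ?F = "free_frame X" and ?P = "presented_frame X R" and ?N = "{A. finite A \<and> A \<subseteq> X} \<times> (UNIV :: nat set)"
  interpret F: frame ?F by (rule frame_free_frame)
  have \<theta>: "frame_congruence ?F \<theta>" unfolding \<theta>_def by (rule F.frame_congruence_generated[OF R])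
  have P: "?P = quotient_frame ?F \<theta>" by (simp add: presented_frame_def \<theta>_def)
  interpret P: frame ?P by (rule frame_presented_frame[OF R])
  define cls where "cls U = \<theta> `` {U}" for U
  have cls_lub: "is_lub ?P (cls (\<Union>S)) (cls ` S)" if "S \<subseteq> carrier ?F" for S
    using F.is_lub_quotient_frame[OF \<theta> that] by (simp add: P cls_def Sup_free_frame[OF that])
  have cls_in: "cls U \<in> carrier ?P" if "U \<in> carrier ?F" for U
    using that by (simp add: P cls_def quotientI)
  have cls_le: "cls U \<sqsubseteq>\<^bsub>?P\<^esub> cls V \<longleftrightarrow> (U \<inter> V, U) \<in> \<theta>"
    if "U \<in> carrier ?F" "V \<in> carrier ?F" for U V
    using F.le_quotient_iff[OF \<theta> that] by (simp add: P cls_def meet_free_frame that)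
  have con_fin: "finite F" "F \<subseteq> X" "\<And>G. G \<in> Q \<Longrightarrow> finite G \<and> G \<subseteq> X"
    if FQ: "con n = (F, Q)" for n F Q
  proof -
    have "(F, Q) \<in> constraints R" using FQ con by (metis rangeI)
    then consider "F = {}" "Q = {{}}" | P where "P \<in> carrier ?F" "Q \<in> carrier ?F" "F \<in> P"
      using R unfolding constraints_def by blast
    then have "finite F \<and> F \<subseteq> X \<and> (\<forall>G\<in>Q. finite G \<and> G \<subseteq> X)"
      by cases (use free_frame_memD in blast)+
    then show "finite F" "F \<subseteq> X" "\<And>G. G \<in> Q \<Longrightarrow> finite G \<and> G \<subseteq> X" by blast+
  qed
  \<comment> \<open>Let \<open>P\<close> and \<open>Q\<close> be related, with
    \<open>F \<in> P\<close>. Then \<open>up_gen X A\<close> is contained in \<open>P\<close>, and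
    meeting the pair with it leaves \<open>up_gen X A\<close> on one side and the stated union on
    the other.\<close>
  have serve: "(up_gen X A, \<Union>G\<in>Q. up_gen X (A \<union> G)) \<in> \<theta>"
    if FQ: "con n = (F, Q)" and A: "finite A" "A \<subseteq> X" and FA: "F \<subseteq> A" for n F Q A
  proof -
    have "(F, Q) \<in> constraints R" using FQ con by (metis rangeI)
    then consider "F = {}" "Q = {{}}" | P where "(P, Q) \<in> \<theta>" "F \<in> P"
      using F.cong_sym[OF \<theta>] generated_congruence_incl[of R ?F]
      unfolding constraints_def \<theta>_def[symmetric] by blast
    then show ?thesis
    proof cases
      case 1
      then show ?thesis using F.cong_refl[OF \<theta> up_gen_in_carrier[of X A]] by simp
    next
      case 2
      then have c: "P \<in> carrier ?F" "Q \<in> carrier ?F" using F.cong_carrier[OF \<theta>] by blast+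
      have "(up_gen X A \<sqinter>\<^bsub>?F\<^esub> P, up_gen X A \<sqinter>\<^bsub>?F\<^esub> Q) \<in> \<theta>"
        by (rule F.cong_meet[OF \<theta> F.cong_refl[OF \<theta> up_gen_in_carrier] 2(1)])
      moreover have "up_gen X A \<inter> P = up_gen X A"
      proof -
        have "H \<in> P" if "H \<in> up_gen X A" for H
          by (rule free_frame_memD(3)[OF c(1) 2(2)]) (use that FA in \<open>auto simp: up_gen_def\<close>)
        then show ?thesis by blast
      qed
      moreover have "up_gen X A \<inter> Q = (\<Union>G\<in>Q. up_gen X (A \<union> G))"
      proof (intro equalityI subsetI)
        fix H assume "H \<in> up_gen X A \<inter> Q"
        then have "H \<in> Q" "H \<in> up_gen X (A \<union> H)" by (auto simp: up_gen_def)
        then show "H \<in> (\<Union>G\<in>Q. up_gen X (A \<union> G))" by blast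
      next
        fix H assume "H \<in> (\<Union>G\<in>Q. up_gen X (A \<union> G))"
        then obtain G where G: "G \<in> Q" "H \<in> up_gen X (A \<union> G)" by blast
        have "H \<in> Q"
          by (rule free_frame_memD(3)[OF c(2) G(1)]) (use G(2) in \<open>auto simp: up_gen_def\<close>)
        then show "H \<in> up_gen X A \<inter> Q" using G(2) by (auto simp: up_gen_def)
      qed
      ultimately show ?thesis by (simp add: meet_free_frame up_gen_in_carrier c)
    qed
  qed
  let ?val = "\<lambda>(A, k :: nat). cls (up_gen X A)"
  have "tree_presentation ?P ?N (pres_children con) ?val"
    unfolding tree_presentation_def
  proof (intro conjI allI ballI impI)
    show "?val \<in> ?N \<rightarrow> carrier ?P" using cls_in[OF up_gen_in_carrier] by auto
  next
    fix s assume "s \<in> ?N"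
    then obtain A k where s: "s = (A, k)" and A: "finite A" "A \<subseteq> X" by blast
    obtain F Q where FQ: "con (fst (prod_decode k)) = (F, Q)" by fastforce
    have ch: "pres_children con (A, k) = (if F \<subseteq> A then (\<lambda>G. (A \<union> G, Suc k)) ` Q else {(A, Suc k)})"
      by (simp add: pres_children_def FQ)
    show "pres_children con s \<subseteq> ?N"
      unfolding s ch using A con_fin(3)[OF FQ] by auto
    show "is_lub ?P (?val s) (?val ` pres_children con s)"
    proof (cases "F \<subseteq> A")
      case True
      have "cls (up_gen X A) = cls (\<Union>G\<in>Q. up_gen X (A \<union> G))"
        unfolding cls_def by (rule equiv_class_eq[OF F.cong_equiv[OF \<theta>] serve[OF FQ A True]])
      moreover have "is_lub ?P (cls (\<Union>G\<in>Q. up_gen X (A \<union> G))) (cls ` (\<lambda>G. up_gen X (A \<union> G)) ` Q)"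
        by (rule cls_lub) (use up_gen_in_carrier in blast)
      ultimately show ?thesis by (simp add: ch True s image_image)
    next
      case False
      \<comment> \<open>The constraint does not apply yet: the only child has the same value and
        merely advances the level.\<close>
      have "is_lub ?P (cls (\<Union>{up_gen X A})) (cls ` {up_gen X A})"
        by (rule cls_lub) (simp add: up_gen_in_carrier)
      then show ?thesis by (simp add: ch False s)
    qed
  next
    fix a assume "a \<in> carrier ?P"
    then obtain U where U: "U \<in> carrier ?F" "a = cls U"
      unfolding P quotient_frame_sel cls_def by (rule F.carrier_quotientE[OF \<theta>])
    have "U = \<Union>(up_gen X ` U)"
    proof (intro equalityI subsetI)
      fix F assume "F \<in> U"
      then show "F \<in> \<Union>(up_gen X ` U)" using free_frame_memD(1,2)[OF U(1)] by (auto simp: up_gen_def)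
    next
      fix G assume "G \<in> \<Union>(up_gen X ` U)"
      then obtain F where "F \<in> U" "finite G" "F \<subseteq> G" "G \<subseteq> X" by (auto simp: up_gen_def)
      then show "G \<in> U" using free_frame_memD(3)[OF U(1)] by blast
    qed
    then have "is_lub ?P a (cls ` up_gen X ` U)"
      using cls_lub[of "up_gen X ` U"] U(2) up_gen_in_carrier by auto
    then have "is_lub ?P a (?val ` (\<lambda>A. (A, 0)) ` U)" by (simp add: image_image)
    moreover have "(\<lambda>A. (A, 0)) ` U \<subseteq> ?N" using free_frame_memD(1,2)[OF U(1)] by auto
    ultimately show "\<exists>S\<subseteq>?N. is_lub ?P a (?val ` S)" by blast
  next
    fix b D d
    assume *: "(\<forall>k. b k \<in> ?N \<and> b (Suc k) \<in> pres_children con (b k)) \<and> D \<subseteq> carrier ?P \<and>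
      is_lub ?P d D \<and> ?val (b 0) \<sqsubseteq>\<^bsub>?P\<^esub> d"
    then have bN: "b k \<in> ?N" and bch: "b (Suc k) \<in> pres_children con (b k)" for k
      by (simp_all only:)
    from * have D: "D \<subseteq> carrier ?P" and lub: "is_lub ?P d D" and le: "?val (b 0) \<sqsubseteq>\<^bsub>?P\<^esub> d"
      by (simp_all only:)
    define A where "A k = fst (b k)" for k
    \<comment> \<open>A branch may start at any level, so all level counts below are shifted by
      \<open>m\<close>.\<close>
    define m where "m = snd (b 0)"
    have A: "finite (A k)" "A k \<subseteq> X" for k using bN[of k] by (auto simp: A_def)
    have snd_b: "snd (b k) = m + k" for k
    proof (induction k)
      case (Suc k)
      then show ?case
        using bch[of k] by (auto simp: pres_children_def split_beta Let_def split: if_splits)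
    qed (simp add: m_def)
    have b: "b k = (A k, m + k)" for k by (simp add: A_def snd_b[symmetric])
    have A_Suc: "A k \<subseteq> A (Suc k)" for k
      using bch[of k] by (auto simp: pres_children_def split_beta Let_def A_def split: if_splits)
    have A_mono: "A j \<subseteq> A k" if "j \<le> k" for j k using lift_Suc_mono_le[of A] A_Suc that by blast
    \<comment> \<open>The point described by the branch: all generators that it ever
      collects.\<close>
    define p where "p = (\<Union>k. A k)"
    have finite_sub: "\<exists>k. G \<subseteq> A k" if "finite G" "G \<subseteq> p" for G
      using that
    proof (induction G)
      case (insert x G)
      then obtain j k where "G \<subseteq> A j" "x \<in> A k" by (auto simp: p_def)
      then have "insert x G \<subseteq> A (max j k)" using A_mono[of j "max j k"] A_mono[of k "max j k"] by auto
      then show ?case by blast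
    qed simp
    have served: "\<exists>G\<in>Q. G \<subseteq> p" if FQ: "(F, Q) \<in> constraints R" "F \<subseteq> p" for F Q
    proof -
      obtain n where n: "con n = (F, Q)" using FQ(1) con by (metis imageE)
      obtain k where k: "F \<subseteq> A k" using finite_sub con_fin(1)[OF n] FQ(2) by blast
      \<comment> \<open>Level \<open>m + j\<close> serves constraint \<open>n\<close>. Pairing
        \<open>n\<close> with \<open>m + k\<close> makes the code at least \<open>m + k\<close>, so
        the subtraction is exact and \<open>k \<le> j\<close>: by then \<open>F\<close> has been
        collected.\<close>
      define j where "j = prod_encode (n, m + k) - m"
      have j: "m + j = prod_encode (n, m + k)" "k \<le> j"
        using le_prod_encode_2[of "m + k" n] by (auto simp: j_def)
      have "F \<subseteq> A j" using k A_mono[OF j(2)] by blast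
      then have "b (Suc j) \<in> (\<lambda>G. (A j \<union> G, Suc (m + j))) ` Q"
        using bch[of j] unfolding b[of j] by (simp add: pres_children_def j(1) n)
      then obtain G where "G \<in> Q" "G \<subseteq> A (Suc j)" by (auto simp: A_def)
      then show ?thesis by (auto simp: p_def)
    qed
    \<comment> \<open>Both directions of each relation occur among the constraints, hence the
      equivalence.\<close>
    have "R \<subseteq> {(U, V). U \<in> carrier ?F \<and> V \<in> carrier ?F \<and> (hits p U \<longleftrightarrow> hits p V)}"
    proof clarify
      fix P Q assume PQ: "(P, Q) \<in> R"
      have "(G, Q) \<in> constraints R" if "G \<in> P" for G using that PQ unfolding constraints_def by blast
      moreover have "(G, P) \<in> constraints R" if "G \<in> Q" for G using that PQ unfolding constraints_def by blast
      ultimately have "hits p P \<longleftrightarrow> hits p Q" unfolding hits_def using served by meson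
      then show "P \<in> carrier ?F \<and> Q \<in> carrier ?F \<and> (hits p P \<longleftrightarrow> hits p Q)" using R PQ by blast
    qed
    from generated_congruence_least[OF frame_congruence_hits this]
    have \<theta>_hits: "hits p U \<longleftrightarrow> hits p V" if "(U, V) \<in> \<theta>" for U V
      using that unfolding \<theta>_def by blast
    obtain S where S: "S \<subseteq> carrier ?F" "D = cls ` S"
      using D unfolding P quotient_frame_sel cls_def by (rule F.quotient_subset_imageE[OF \<theta>])
    have "d = cls (\<Union>S)" using lub cls_lub[OF S(1)] P.least_unique unfolding S(2) by blast
    then have "(up_gen X (A 0) \<inter> \<Union>S, up_gen X (A 0)) \<in> \<theta>"
      using le cls_le[OF up_gen_in_carrier Union_in_carrier_free_frame[OF S(1)]] by (simp add: b)
    \<comment> \<open>\<open>A 0\<close> itself is the witness. Transfer along \<theta> then yields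
      a finite \<open>G \<subseteq> p\<close> in some \<open>U \<in> S\<close>, and any
      \<open>A k\<close> containing \<open>G\<close> has its value below the class of
      \<open>U\<close>.\<close>
    moreover have "hits p (up_gen X (A 0))"
      using A by (auto simp: hits_def up_gen_def p_def)
    ultimately have "hits p (up_gen X (A 0) \<inter> \<Union>S)" using \<theta>_hits by blast
    then obtain U G where UG: "U \<in> S" "G \<in> U" "G \<subseteq> p" unfolding hits_def by blast
    have U: "U \<in> carrier ?F" using UG(1) S(1) by blast
    obtain k where k: "G \<subseteq> A k" using finite_sub free_frame_memD(1)[OF U UG(2)] UG(3) by blast
    have "up_gen X (A k) \<inter> U = up_gen X (A k)"
      using free_frame_memD(3)[OF U UG(2)] k by (auto simp: up_gen_def)
    then have "?val (b k) \<sqsubseteq>\<^bsub>?P\<^esub> cls U"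
      using F.cong_refl[OF \<theta> up_gen_in_carrier] by (simp add: b cls_le[OF up_gen_in_carrier U])
    then show "\<exists>k. \<exists>x\<in>D. ?val (b k) \<sqsubseteq>\<^bsub>?P\<^esub> x" using UG(1) S(2) by blast
  qed
  then show ?thesis by (simp add: cls_def)
qed

text \<open>The node type is the same for every \<open>L\<close>, so trees for all factors of a
  product can be chosen together.\<close>

lemma tree_presentation_countably_presented_frame:
  assumes "countably_presented_frame L"
  shows "\<exists>(N :: (nat set \<times> nat) set) ch val. tree_presentation L N ch val"
proof -
  obtain X :: "nat set" and R where L: "frame L"
    and R: "R \<subseteq> carrier (free_frame X) \<times> carrier (free_frame X)" "countable R"
    and iso: "frame_isomorphic L (presented_frame X R)"
    using assms unfolding countably_presented_frame_def by blast
  have "range (from_nat_into (constraints R)) = constraints R"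
    using countable_constraints[OF R(2,1)] by (intro range_from_nat_into) (auto simp: constraints_def)
  note pres = tree_presentation_presented_frame[OF R(1) this]
  obtain f where "bij_betw f (carrier L) (carrier (presented_frame X R))"
    "\<And>x y. x \<in> carrier L \<Longrightarrow> y \<in> carrier L \<Longrightarrow> x \<sqsubseteq>\<^bsub>L\<^esub> y \<longleftrightarrow> f x \<sqsubseteq>\<^bsub>presented_frame X R\<^esub> f y"
    using frame_isomorphicE[OF L frame_presented_frame[OF R(1)] iso] by blast
  from tree_presentation_order_iso[OF pres this] show ?thesis by blast
qed

theorem theorem4p8:
  fixes I :: "'i set" and L :: "'i \<Rightarrow> 'a gorder"
  assumes "\<And>i. i \<in> I \<Longrightarrow> countably_presented_frame (L i)"
  shows "sober_space (scott_topology (product_order I L))"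
proof -
  have L: "complete_lattice (L i)" if "i \<in> I" for i
    using assms[OF that] by (simp add: countably_presented_frame_def frame_def)
  \<comment> \<open>Nodes, children and values are packed into one triple so that a single choice
    over \<open>I\<close> selects them.\<close>
  have "\<forall>i\<in>I. \<exists>T :: (nat set \<times> nat) set \<times> _ \<times> _. tree_presentation (L i) (fst T) (fst (snd T)) (snd (snd T))"
    using tree_presentation_countably_presented_frame[OF assms] by simp
  from bchoice[OF this] obtain T :: "'i \<Rightarrow> (nat set \<times> nat) set \<times> _ \<times> _" where
    "\<And>i. i \<in> I \<Longrightarrow> tree_presentation (L i) (fst (T i)) (fst (snd (T i))) (snd (snd (T i)))" by blast
  note pres = tree_presentation_product_order[OF L this]
  interpret plain_complete_lattice "product_order I L"
    by (rule plain_complete_lattice.intro, rule complete_lattice_product_order[OF L])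
  show ?thesis
    by (rule sober_scott_topology_if_join_continuous,
        rule join_continuous_if_tree_presentation[OF pres])
qed

end
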